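(* For $r\ge 2$ let $\mathfrak{f}_r(z)=\sum_{n\ge0}\frac{-1}{2n-1}\binom{2n}{n}^r z^n$. Then the series $\{\mathfrak{f}_r\}_{r\ge2}$ are algebraically independent over $\mathbb{Q}(z)$, i.e. for every $l\ge 2$ the series $\mathfrak{f}_2,\dots,\mathfrak{f}_l$ are algebraically independent over $\mathbb{Q}(z)$. *)

theory Defs
  imports "HOL-Computational_Algebra.Computational_Algebra"
begin

definition frakf :: "nat \<Rightarrow> rat fps" where
  "frakf r = Abs_fps (\<lambda>n. - 1 / (2 * of_nat n - 1) * of_nat ((2 * n choose n) ^ r))"

definition ratfun_to_fls :: "rat poly fract \<Rightarrow> rat fls" where
  "ratfun_to_fls q = (THE y. \<exists>a b. b \<noteq> 0 \<and> q = Fract a b \<and>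
      y = fps_to_fls (fps_of_poly a) / fps_to_fls (fps_of_poly b))"

text \<open>Algebraic independence over Q(z) of the family F i (i in a finite index set I),
  inside the field Q((z)): a multivariate polynomial over Q(z) in variables X_i (i in I)
  is given by a finite set S of exponent vectors (supported in I) and coefficients c;
  if it vanishes at (F i)_{i in I}, all coefficients are zero.\<close>
definition alg_indep_over_Qz :: "(nat \<Rightarrow> rat fps) \<Rightarrow> nat set \<Rightarrow> bool" where
  "alg_indep_over_Qz F I \<longleftrightarrow>
     (\<forall>(S :: (nat \<Rightarrow> nat) set) (c :: (nat \<Rightarrow> nat) \<Rightarrow> rat poly fract).
        finite S \<longrightarrow> (\<forall>e\<in>S. \<forall>i. i \<notin> I \<longrightarrow> e i = 0) \<longrightarrow>
        (\<Sum>e\<in>S. ratfun_to_fls (c e) * (\<Prod>i\<in>I. fps_to_fls (F i) ^ e i)) = 0 \<longrightarrow>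
        (\<forall>e\<in>S. c e = 0))"

end

theory Submission
  imports Defs "HOL-Algebra.Algebraic_Closure_Type" "Berlekamp_Zassenhaus.Finite_Field"
begin

hide_const (open) Divisibility.prime Coset.order up_ring.monom up_ring.coeff Polynomials.degree
  module.smult

text \<open>Write \<open>g\<^sub>r\<close> for the series with coefficients \<open>binom(2n, n)\<^sup>r\<close>. The series \<open>f\<^sub>r\<close> has integer
  coefficients, and modulo an odd prime \<open>p\<close> congruences of Lucas type give \<open>f\<^sub>r = A\<^sub>r g\<^sub>r\<^sup>p\<close> and
  \<open>g\<^sub>r = B\<^sub>r g\<^sub>r\<^sup>p\<close> with polynomials \<open>A\<^sub>r\<close> and \<open>B\<^sub>r\<close>, where \<open>B\<^sub>r\<close> is \<open>g\<^sub>r\<close> truncated at \<open>z\<^sup>p\<close> and has degree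
  at most \<open>(p - 1) / 2\<close>. An algebraic relation between the \<open>f\<^sub>r\<close> thus becomes a linear relation over
  \<open>K[z]\<close>, with \<open>K\<close> algebraically closed of characteristic \<open>p\<close>, between monomials in the \<open>g\<^sub>r\<close>, and Frobenius turns it into an identity
  \<open>B\<^sup>e x\<^sup>p\<^sup>-\<^sup>1 = B\<^sup>e\<^sup>' y\<^sup>p\<^sup>-\<^sup>1\<close> for two exponent vectors \<open>e \<noteq> e'\<close> of the relation. The hypergeometric
  differential equation of \<open>g\<^sub>r\<close> bounds the multiplicities of the roots of \<open>B\<^sub>r\<close> by \<open>r - 1\<close>, so for large
  \<open>p\<close> the identity forces \<open>B\<^sup>e = B\<^sup>e\<^sup>'\<close>, i.e. \<open>g\<^sup>e\<close> and \<open>g\<^sup>e\<^sup>'\<close> agree modulo \<open>p\<close> and \<open>z\<^sup>p\<close>. Over the integers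
  they differ, because the coefficients of \<open>g\<^sub>r\<close> grow like \<open>4\<^sup>r\<^sup>n\<close>; hence they differ modulo large \<open>p\<close>.\<close>

section \<open>Central binomial series\<close>

definition central_binom :: "nat \<Rightarrow> nat" where
  "central_binom n = (2 * n choose n)"

definition central_fps :: "nat \<Rightarrow> 'a::comm_ring_1 fps" where
  "central_fps r = Abs_fps (\<lambda>n. of_nat (central_binom n ^ r))"

text \<open>The division is exact by \<open>central_binom_factor\<close>: one binomial factor
  absorbs the denominator, so the series can be reduced modulo primes. At \<open>n = 0\<close> the
  divisor is \<open>-1\<close>, which gives the value 1.\<close>

definition frakf_coeff :: "nat \<Rightarrow> nat \<Rightarrow> int" where
  "frakf_coeff r n = - (int (central_binom n) div (2 * int n - 1)) * int (central_binom n) ^ (r - 1)"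

definition frakf_fps :: "nat \<Rightarrow> 'a::comm_ring_1 fps" where
  "frakf_fps r = Abs_fps (\<lambda>n. of_int (frakf_coeff r n))"

section \<open>Base change of integer series to the rationals and to characteristic
  \<open>p\<close>\<close>

definition fps_of_int_fps :: "int fps \<Rightarrow> 'a::comm_ring_1 fps" where
  "fps_of_int_fps f = Abs_fps (\<lambda>n. of_int (fps_nth f n))"

lemma fps_of_int_fps_nth [simp]: "fps_nth (fps_of_int_fps f) n = of_int (fps_nth f n)"
  by (simp add: fps_of_int_fps_def)

lemma fps_of_int_fps_simps:
  "fps_of_int_fps 0 = 0" "fps_of_int_fps 1 = 1"
  "fps_of_int_fps (f + g) = fps_of_int_fps f + fps_of_int_fps g"
  "fps_of_int_fps (f * g) = fps_of_int_fps f * fps_of_int_fps g"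
  by (simp_all add: fps_eq_iff fps_mult_nth)

lemma fps_of_int_fps_power: "fps_of_int_fps (f ^ n) = fps_of_int_fps f ^ n"
  by (induction n) (simp_all add: fps_of_int_fps_simps)

lemma fps_of_int_fps_sum: "fps_of_int_fps (\<Sum>x\<in>A. f x) = (\<Sum>x\<in>A. fps_of_int_fps (f x))"
  by (induction A rule: infinite_finite_induct) (simp_all add: fps_of_int_fps_simps)

lemma fps_of_int_fps_prod: "fps_of_int_fps (\<Prod>x\<in>A. f x) = (\<Prod>x\<in>A. fps_of_int_fps (f x))"
  by (induction A rule: infinite_finite_induct) (simp_all add: fps_of_int_fps_simps)

lemma fps_of_int_fps_of_poly:
  "fps_of_int_fps (fps_of_poly q) = fps_of_poly (map_poly of_int q)"
  by (simp add: fps_eq_iff coeff_map_poly)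

lemma inj_fps_of_int_fps: "inj (fps_of_int_fps :: int fps \<Rightarrow> 'a::{comm_ring_1,ring_char_0} fps)"
  by (auto simp: inj_def fps_eq_iff)

lemma fps_of_int_fps_central: "fps_of_int_fps (central_fps r) = central_fps r"
  by (simp add: fps_eq_iff central_fps_def)

lemma fps_of_int_fps_frakf: "fps_of_int_fps (frakf_fps r) = frakf_fps r"
  by (simp add: fps_eq_iff frakf_fps_def)

lemma central_binom_0 [simp]: "central_binom 0 = 1"
  by (simp add: central_binom_def)

lemma central_binom_Suc:
  "Suc n * central_binom (Suc n) = 2 * (2 * n + 1) * central_binom n"
proof -
  have *: "central_binom n * (fact n * fact n) = fact (2 * n)" for n
    using binomial_fact_lemma[of n "2 * n"] by (simp add: central_binom_def mult_ac)
  have "(Suc n * central_binom (Suc n)) * (Suc n * (fact n * fact n)) = fact (2 * Suc n)"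
    using *[of "Suc n"] by (simp add: algebra_simps)
  also have "\<dots> = (2 * n + 2) * (2 * n + 1) * fact (2 * n)"
    by (simp add: algebra_simps)
  also have "\<dots> = (2 * (2 * n + 1) * central_binom n) * (Suc n * (fact n * fact n))"
    unfolding *[of n, symmetric] by (simp add: algebra_simps)
  finally show ?thesis
    by (subst (asm) mult_cancel2) simp
qed

text \<open>For \<open>n = Suc m\<close> the recurrence gives the quotient explicitly as
  \<open>4 * central_binom m - central_binom n\<close>.\<close>

lemma central_binom_factor:
  "(2 * int n - 1) * (int (central_binom n) div (2 * int n - 1)) = int (central_binom n)"
proof (cases n)
  case (Suc m)
  have "int (Suc m * central_binom (Suc m)) = int (2 * (2 * m + 1) * central_binom m)"
    by (simp only: central_binom_Suc)
  hence "int (central_binom n) = (2 * int n - 1) * (4 * int (central_binom m) - int (central_binom n))"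
    by (simp add: Suc algebra_simps)
  hence "(2 * int n - 1) dvd int (central_binom n)"
    by (metis dvd_triv_left)
  thus ?thesis by simp
qed simp

lemma central_products_nth_0 [simp]:
  "fps_nth (\<Prod>i\<in>I. central_fps i ^ e i) 0 = (1 :: 'a::comm_ring_1)"
  by (induction I rule: infinite_finite_induct) (simp_all add: fps_power_zeroth central_fps_def)

lemma frakf_coeff_0 [simp]: "frakf_coeff r 0 = 1"
  by (simp add: frakf_coeff_def)

lemma frakf_coeff_mult:
  assumes "r \<ge> 1"
  shows "(2 * int n - 1) * frakf_coeff r n = - (int (central_binom n) ^ r)"
proof -
  have "(2 * int n - 1) * frakf_coeff r n
      = - ((2 * int n - 1) * (int (central_binom n) div (2 * int n - 1))) * int (central_binom n) ^ (r - 1)"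
    by (simp add: frakf_coeff_def)
  also have "\<dots> = - (int (central_binom n) ^ r)"
    unfolding central_binom_factor using assms by (cases r) auto
  finally show ?thesis .
qed

lemma frakf_eq: "r \<ge> 1 \<Longrightarrow> frakf r = frakf_fps r"
proof (rule fps_ext)
  fix n assume "r \<ge> 1"
  have "(2 * rat_of_nat n - 1) * of_int (frakf_coeff r n) = of_int ((2 * int n - 1) * frakf_coeff r n)"
    by simp
  also have "\<dots> = - rat_of_nat (central_binom n ^ r)"
    by (subst frakf_coeff_mult[OF \<open>r \<ge> 1\<close>]) simp
  finally have "(2 * rat_of_nat n - 1) * of_int (frakf_coeff r n) = - rat_of_nat (central_binom n ^ r)" .
  moreover have "2 * rat_of_nat n - 1 \<noteq> 0"
  proof
    assume "2 * rat_of_nat n - 1 = 0"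
    hence "rat_of_nat (2 * n) = rat_of_nat 1" by simp
    hence "2 * n = 1" by (simp only: of_nat_eq_iff)
    thus False by presburger
  qed
  ultimately show "fps_nth (frakf r) n = fps_nth (frakf_fps r) n"
    by (simp add: frakf_def frakf_fps_def central_binom_def field_simps)
qed

text \<open>The series is \<open>1 - 4 z\<close> to the power \<open>-1/2\<close>. The recurrence
  gives \<open>u' (1 - 4 z) = 2 u\<close>, so the left side has derivative zero and is constant over
  the integers. The next lemma transports the identity, since in positive characteristic a zero
  derivative would not suffice.\<close>

lemma central_fps_square_int: "central_fps 1 ^ 2 * (1 - 4 * fps_X) = (1 :: int fps)"
proof -
  let ?u = "central_fps 1 :: int fps"
  have ode: "fps_deriv ?u * (1 - 4 * fps_X) = 2 * ?u"
  proof (rule fps_ext)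
    fix n
    have "fps_nth (fps_deriv ?u * (1 - 4 * fps_X)) n =
       int (Suc n * central_binom (Suc n)) - 4 * (int n * central_binom n)"
      by (cases n; simp add: right_diff_distrib central_fps_def mult.left_commute[of _ 4]
            numeral_fps_const fps_mult_left_const_nth flip: mult.assoc; simp add: algebra_simps)
    also have "\<dots> = fps_nth (2 * ?u) n"
      unfolding central_binom_Suc by (simp add: central_fps_def algebra_simps numeral_fps_const)
    finally show "fps_nth (fps_deriv ?u * (1 - 4 * fps_X)) n = fps_nth (2 * ?u) n" .
  qed
  have "fps_deriv (?u ^ 2 * (1 - 4 * fps_X)) = 2 * ?u * (fps_deriv ?u * (1 - 4 * fps_X)) - 4 * ?u ^ 2"
    by (simp add: fps_deriv_power power2_eq_square algebra_simps numeral_fps_const)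
  also have "\<dots> = 0"
    unfolding ode by (simp add: power2_eq_square algebra_simps)
  finally have "?u ^ 2 * (1 - 4 * fps_X) = fps_const (fps_nth (?u ^ 2 * (1 - 4 * fps_X)) 0)"
    by (simp only: fps_deriv_eq_0_iff)
  thus ?thesis
    by (simp add: central_fps_def fps_power_zeroth)
qed

lemma central_fps_square: "central_fps 1 ^ 2 * (1 - 4 * fps_X) = (1 :: 'a::comm_ring_1 fps)"
proof -
  have "fps_of_int_fps (1 - 4 * fps_X) = (1 - 4 * fps_X :: 'a fps)"
    by (simp add: fps_eq_iff numeral_fps_const)
  with arg_cong[OF central_fps_square_int, of "fps_of_int_fps :: int fps \<Rightarrow> 'a fps"]
  show ?thesis
    by (simp add: fps_of_int_fps_simps fps_of_int_fps_power fps_of_int_fps_central)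
qed

section \<open>Lucas congruences\<close>

text \<open>Only the truncation of \<open>f\<close> at degree \<open>n\<close> matters: the
  remainder is a multiple of \<open>fps_X ^ Suc n\<close>, and so is its \<open>p\<close>-th power.
  The truncation is a finite sum, to which the freshman's dream applies.\<close>

lemma fps_power_CHAR_nth:
  fixes f :: "'a::comm_ring_1 fps"
  assumes p: "prime CHAR('a)"
  shows "fps_nth (f ^ CHAR('a)) n =
           (if CHAR('a) dvd n then fps_nth f (n div CHAR('a)) ^ CHAR('a) else 0)"
proof -
  let ?p = "CHAR('a)"
  have pos: "?p > 0" using p by (simp add: prime_gt_0_nat)
  have less: "n < Suc n * ?p"
    using pos by (cases ?p) auto
  define q where "q = (\<Sum>i\<le>n. fps_const (fps_nth f i) * fps_X ^ i)"
  define h where "h = fps_shift (Suc n) f"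
  have f: "f = q + h * fps_X ^ Suc n"
  proof (rule fps_ext)
    fix k
    have "(\<Sum>i\<le>n. fps_nth f i * (if k = i then 1 else 0)) = (if k \<le> n then fps_nth f k else 0)"
      by (simp add: if_distrib[of "(*) _"] cong: if_cong)
    hence "fps_nth q k = (if k \<le> n then fps_nth f k else 0)"
      by (simp add: q_def fps_sum_nth)
    thus "fps_nth f k = fps_nth (q + h * fps_X ^ Suc n) k"
      by (auto simp: h_def fps_X_power_mult_right_nth simp del: power_Suc)
  qed
  have "f ^ ?p = q ^ ?p + (h * fps_X ^ Suc n) ^ ?p"
    by (subst f, rule freshmans_dream) (use p in auto)
  also have "(h * fps_X ^ Suc n) ^ ?p = h ^ ?p * fps_X ^ (Suc n * ?p)"
    by (simp only: power_mult_distrib power_mult)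
  also have "q ^ ?p = (\<Sum>i\<le>n. (fps_const (fps_nth f i) * fps_X ^ i) ^ ?p)"
    unfolding q_def by (rule freshmans_dream_sum) (use p in auto)
  also have "\<dots> = (\<Sum>i\<le>n. fps_const (fps_nth f i ^ ?p) * fps_X ^ (i * ?p))"
    by (simp add: power_mult_distrib power_mult fps_const_power)
  finally have "f ^ ?p = (\<Sum>i\<le>n. fps_const (fps_nth f i ^ ?p) * fps_X ^ (i * ?p))
      + h ^ ?p * fps_X ^ (Suc n * ?p)" .
  moreover have "fps_nth (h ^ ?p * fps_X ^ (Suc n * ?p)) n = 0"
    using less by (simp only: fps_X_power_mult_right_nth if_True)
  ultimately have "fps_nth (f ^ ?p) n = (\<Sum>i\<le>n. fps_nth f i ^ ?p * (if n = i * ?p then 1 else 0))"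
    by (simp add: fps_sum_nth)
  also have "\<dots> = (\<Sum>i\<le>n. if i = n div ?p then (if ?p dvd n then fps_nth f i ^ ?p else 0) else 0)"
    by (intro sum.cong) (use pos in auto)
  also have "\<dots> = (if ?p dvd n then fps_nth f (n div ?p) ^ ?p else 0)"
    by (subst sum.delta) auto
  finally show ?thesis .
qed

lemma of_nat_power_CHAR:
  assumes "prime CHAR('a::comm_ring_1)"
  shows "(of_nat n :: 'a) ^ CHAR('a) = of_nat n"
proof (induction n)
  case 0
  show ?case using prime_gt_0_nat[OF assms] by (simp add: power_0_left)
next
  case (Suc n)
  show ?case
    using Suc freshmans_dream[OF assms refl, of 1 "of_nat n"] by simp
qed

text \<open>Among the multiples of \<open>p\<close> only \<open>p * b\<close> is within distance
  less than \<open>p\<close> below \<open>a + p * b\<close>, so the convolution has a single term.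
  This turns factorizations into Lucas congruences.\<close>

lemma fps_mult_lacunary_nth:
  fixes F W :: "'a::comm_ring_1 fps"
  assumes F: "\<And>n. fps_nth F n = (if p dvd n then c (n div p) else 0)"
    and W: "\<And>n. n \<ge> p \<Longrightarrow> fps_nth W n = 0" and a: "a < p"
  shows "fps_nth (F * W) (a + p * b) = c b * fps_nth W a"
proof -
  have "fps_nth (F * W) (a + p * b) = (\<Sum>i=0..a + p * b. fps_nth F i * fps_nth W (a + p * b - i))"
    by (rule fps_mult_nth)
  also have "\<dots> = (\<Sum>i\<in>{p * b}. fps_nth F i * fps_nth W (a + p * b - i))"
  proof (rule sum.mono_neutral_right)
    show "\<forall>i\<in>{0..a + p * b} - {p * b}. fps_nth F i * fps_nth W (a + p * b - i) = 0"
    proof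
      fix i assume i: "i \<in> {0..a + p * b} - {p * b}"
      show "fps_nth F i * fps_nth W (a + p * b - i) = 0"
      proof (cases "p dvd i")
        case True
        then obtain k where k: "i = p * k" by blast
        have "p * k < p * Suc b"
          using i a k by simp
        hence "k < Suc b"
          unfolding mult_less_cancel1 by blast
        moreover have "k \<noteq> b" using i k by auto
        ultimately have "Suc k \<le> b" by simp
        hence "p * Suc k \<le> p * b" by (rule mult_le_mono2)
        hence "a + p * b - i \<ge> p" using k by simp
        thus ?thesis by (simp add: W)
      qed (simp add: F)
    qed
  qed auto
  also have "\<dots> = c b * fps_nth W a"
    using a by (simp add: F)
  finally show ?thesis .
qed

text \<open>This is \<open>B\<^sub>r\<close>, and \<open>frakf_poly\<close> below is
  \<open>A\<^sub>r\<close>.\<close>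

definition central_poly :: "nat \<Rightarrow> 'a::comm_ring_1 poly" where
  "central_poly r = (\<Sum>k<CHAR('a). monom (of_nat (central_binom k ^ r)) k)"

definition frakf_poly :: "nat \<Rightarrow> 'a::comm_ring_1 poly" where
  "frakf_poly r = (\<Sum>k<CHAR('a). monom (of_int (frakf_coeff r k)) k)"

lemma coeff_central_poly:
  "coeff (central_poly r :: 'a::comm_ring_1 poly) n =
     (if n < CHAR('a) then of_nat (central_binom n ^ r) else 0)"
  by (simp add: central_poly_def coeff_sum)

lemma coeff_frakf_poly:
  "coeff (frakf_poly r :: 'a::comm_ring_1 poly) n =
     (if n < CHAR('a) then of_int (frakf_coeff r n) else 0)"
  by (simp add: frakf_poly_def coeff_sum)

lemma central_fps_power_CHAR_nth:
  assumes "prime CHAR('a::comm_ring_1)"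
  shows "fps_nth (central_fps r ^ CHAR('a) :: 'a fps) n =
    (if CHAR('a) dvd n then of_nat (central_binom (n div CHAR('a)) ^ r) else 0)"
  using of_nat_power_CHAR[OF assms, of "central_binom (n div CHAR('a)) ^ r"]
  by (subst fps_power_CHAR_nth[OF assms]) (simp add: central_fps_def)

section \<open>Congruences modulo an odd prime \<open>p = 2 h + 1\<close>\<close>

context
  fixes h :: nat
  assumes prime_char: "prime CHAR('a::field)" and h: "CHAR('a) = 2 * h + 1"
begin

text \<open>Raise \<open>u^2 (1 - 4 z) = 1\<close> to the power \<open>h\<close> and multiply by
  \<open>u\<close>: the exponent of \<open>u\<close> becomes \<open>2 h + 1 = p\<close>.\<close>

lemma central_fps_1_eq:
  "(central_fps 1 :: 'a fps) = central_fps 1 ^ CHAR('a) * fps_of_poly ([:1, -4:] ^ h)"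
proof -
  let ?u = "central_fps 1 :: 'a fps" and ?w = "1 - 4 * fps_X :: 'a fps"
  have w: "fps_of_poly ([:1, -4:] ^ h) = ?w ^ h"
    by (simp add: fps_of_poly_power fps_of_poly_pCons numeral_fps_const mult.commute flip: fps_const_neg)
  have "?u = ?u * (?u ^ 2 * ?w) ^ h"
    unfolding central_fps_square by simp
  also have "\<dots> = ?u ^ CHAR('a) * ?w ^ h"
    unfolding h by (simp add: power_mult_distrib power_mult mult.assoc)
  finally show ?thesis unfolding w .
qed

lemma coeff_linear_power_eq_0: "n > h \<Longrightarrow> coeff ([:1, -4:] ^ h :: 'a poly) n = 0"
  by (rule coeff_eq_0, rule le_less_trans[OF degree_power_le])
     (auto intro: le_less_trans[rotated])

lemma central_binom_lucas_aux:
  assumes "a < CHAR('a)"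
  shows "(of_nat (central_binom (a + CHAR('a) * b)) :: 'a) =
           of_nat (central_binom b) * coeff ([:1, -4:] ^ h) a"
proof -
  have "(of_nat (central_binom (a + CHAR('a) * b)) :: 'a) = fps_nth (central_fps 1) (a + CHAR('a) * b)"
    by (simp add: central_fps_def)
  also have "\<dots> = of_nat (central_binom b ^ 1) * fps_nth (fps_of_poly ([:1, -4:] ^ h)) a"
  proof (subst central_fps_1_eq, rule fps_mult_lacunary_nth)
    show "fps_nth (fps_of_poly ([:1, -4:] ^ h) :: 'a fps) n = 0" if "n \<ge> CHAR('a)" for n
      using that h by (simp add: coeff_linear_power_eq_0)
  qed (use assms in \<open>auto simp: central_fps_power_CHAR_nth prime_char\<close>)
  finally show ?thesis by simp
qed

text \<open>The case \<open>b = 0\<close> identifies the polynomial coefficient with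
  \<open>central_binom a\<close> modulo \<open>p\<close>.\<close>

lemma central_binom_lucas:
  assumes "a < CHAR('a)"
  shows "(of_nat (central_binom (a + CHAR('a) * b)) :: 'a) =
           of_nat (central_binom b) * of_nat (central_binom a)"
  using central_binom_lucas_aux[OF assms, of b] central_binom_lucas_aux[OF assms, of 0] by simp

lemma central_binom_eq_0:
  assumes "h < a" "a < CHAR('a)"
  shows "(of_nat (central_binom a) :: 'a) = 0"
  using central_binom_lucas_aux[OF assms(2), of 0] coeff_linear_power_eq_0[OF assms(1)] by simp

lemma degree_central_poly: "r > 0 \<Longrightarrow> degree (central_poly r :: 'a poly) \<le> h"
  by (rule degree_le) (auto simp: coeff_central_poly central_binom_eq_0 power_0_left)

lemma central_fps_eq:
  "(central_fps r :: 'a fps) = central_fps r ^ CHAR('a) * fps_of_poly (central_poly r)"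
proof (rule fps_ext)
  fix n
  let ?p = "CHAR('a)"
  have p: "?p > 0" using h by simp
  define a where "a = n mod ?p" define b where "b = n div ?p"
  have n: "n = a + ?p * b" and a: "a < ?p" using p by (auto simp: a_def b_def)
  have "fps_nth (central_fps r ^ ?p * fps_of_poly (central_poly r)) n =
      of_nat (central_binom b ^ r) * fps_nth (fps_of_poly (central_poly r) :: 'a fps) a"
    unfolding n by (rule fps_mult_lacunary_nth)
      (use a in \<open>auto simp: central_fps_power_CHAR_nth prime_char coeff_central_poly\<close>)
  also have "\<dots> = fps_nth (central_fps r) n"
    using a unfolding n
    by (simp add: central_fps_def coeff_central_poly central_binom_lucas power_mult_distrib)
  finally show "fps_nth (central_fps r :: 'a fps) n =
      fps_nth (central_fps r ^ ?p * fps_of_poly (central_poly r)) n" ..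
qed

text \<open>Modulo \<open>p\<close> the denominator \<open>2 (a + p b) - 1\<close> depends only on
  \<open>a\<close>; where it is invertible, the congruence for the binomials can be divided by
  it.\<close>

lemma frakf_coeff_lucas:
  assumes a: "a < CHAR('a)" and r: "r \<ge> 2"
  shows "(of_int (frakf_coeff r (a + CHAR('a) * b)) :: 'a) =
           of_nat (central_binom b ^ r) * of_int (frakf_coeff r a)"
proof (cases "of_int (2 * int a - 1) = (0 :: 'a)")
  case False
  let ?n = "a + CHAR('a) * b"
  let ?d = "of_int (2 * int a - 1) :: 'a"
  have d: "of_int (2 * int ?n - 1) = ?d" by simp
  have *: "of_int (2 * int k - 1) * of_int (frakf_coeff r k) = - (of_nat (central_binom k) ^ r :: 'a)" for k
    using r arg_cong[OF frakf_coeff_mult[of r k], of "of_int :: int \<Rightarrow> 'a"]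
    by (simp only: of_int_mult of_int_minus of_int_power of_int_of_nat_eq)
  have "?d * of_int (frakf_coeff r ?n) = - (of_nat (central_binom ?n) ^ r)"
    using *[of ?n] by (simp only: d)
  also have "\<dots> = of_nat (central_binom b ^ r) * - (of_nat (central_binom a) ^ r)"
    using central_binom_lucas[OF a, of b] by (simp add: power_mult_distrib)
  also have "\<dots> = ?d * (of_nat (central_binom b ^ r) * of_int (frakf_coeff r a))"
    by (simp only: *[of a, symmetric] mult.left_commute)
  finally show ?thesis
    unfolding mult_cancel_left using False by blast
next
  case True
  \<comment> \<open>Here \<open>a = h + 1\<close>, where the extra factor \<open>central_binom\<close> kills both sides.\<close>
  have "h < a"
  proof (rule ccontr)
    assume "\<not> h < a"
    have "int CHAR('a) dvd 2 * int a - 1"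
      by (rule of_int_eq_0_iff_char_dvd[THEN iffD1, OF True])
    moreover have "2 * int a - 1 \<noteq> 0" by presburger
    ultimately have "int CHAR('a) \<le> \<bar>2 * int a - 1\<bar>"
      by (metis dvd_imp_le_int abs_of_nat)
    thus False using h \<open>\<not> h < a\<close> prime_gt_1_nat[OF prime_char] by linarith
  qed
  hence 0: "of_nat (central_binom a) = (0 :: 'a)"
    using a by (rule central_binom_eq_0)
  hence "of_nat (central_binom (a + CHAR('a) * b)) = (0 :: 'a)"
    using central_binom_lucas[OF a, of b] by simp
  moreover have "of_int (frakf_coeff r k) = (0 :: 'a)" if "of_nat (central_binom k) = (0 :: 'a)" for k
    using r that by (simp add: frakf_coeff_def power_0_left)
  ultimately show ?thesis
    using 0 by simp
qed

lemma frakf_fps_eq: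
  assumes r: "r \<ge> 2"
  shows "(frakf_fps r :: 'a fps) = central_fps r ^ CHAR('a) * fps_of_poly (frakf_poly r)"
proof (rule fps_ext)
  fix n
  let ?p = "CHAR('a)"
  have p: "?p > 0" using h by simp
  define a where "a = n mod ?p" define b where "b = n div ?p"
  have n: "n = a + ?p * b" and a: "a < ?p" using p by (auto simp: a_def b_def)
  have "fps_nth (central_fps r ^ ?p * fps_of_poly (frakf_poly r)) n =
      of_nat (central_binom b ^ r) * fps_nth (fps_of_poly (frakf_poly r) :: 'a fps) a"
    unfolding n by (rule fps_mult_lacunary_nth)
      (use a in \<open>auto simp: central_fps_power_CHAR_nth prime_char coeff_frakf_poly\<close>)
  also have "\<dots> = fps_nth (frakf_fps r) n"
    using a unfolding n
    by (simp add: frakf_fps_def coeff_frakf_poly frakf_coeff_lucas r)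
  finally show "fps_nth (frakf_fps r :: 'a fps) n =
      fps_nth (central_fps r ^ ?p * fps_of_poly (frakf_poly r)) n" ..
qed

end

section \<open>Multiplicities of roots\<close>

lemma order_power_eq:
  fixes q :: "'a::idom poly"
  assumes "q \<noteq> 0"
  shows "Polynomial.order x (q ^ n) = n * Polynomial.order x q"
  using assms by (induction n) (simp_all add: order_mult)

lemma order_prod_eq:
  fixes q :: "'b \<Rightarrow> 'a::idom poly"
  assumes "finite A" "\<And>i. i \<in> A \<Longrightarrow> q i \<noteq> 0"
  shows "Polynomial.order x (\<Prod>i\<in>A. q i) = (\<Sum>i\<in>A. Polynomial.order x (q i))"
  using assms by (induction A rule: finite_induct) (simp_all add: order_mult)

text \<open>At a root \<open>x\<close> of \<open>a\<close> or \<open>b\<close> compare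
  multiplicities: those of \<open>U\<close> and \<open>V\<close> are remainders modulo
  \<open>n\<close>, so \<open>a\<close> and \<open>b\<close> vanish at \<open>x\<close> to the same
  order. Cancelling common linear factors leads to constants, where evaluation at 0 fixes the
  scalar.\<close>

lemma poly_eq_if_power_multiples_eq:
  fixes U V a b :: "'a::alg_closed_field poly"
  assumes U: "poly U 0 = 1" "\<And>x. Polynomial.order x U < n"
    and V: "poly V 0 = 1" "\<And>x. Polynomial.order x V < n"
    and eq: "U * a ^ n = V * b ^ n" and nz: "a \<noteq> 0" "b \<noteq> 0"
  shows "U = V"
  using eq nz
proof (induction "degree a + degree b" arbitrary: a b rule: less_induct)
  case less
  have UV: "U \<noteq> 0" "V \<noteq> 0" using U(1) V(1) by auto
  show ?case
  proof (cases "degree a = 0 \<and> degree b = 0")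
    case True
    then obtain c d where cd: "a = [:c:]" "b = [:d:]"
      using degree_eq_zeroE by metis
    have "c ^ n = d ^ n"
      using arg_cong[OF less.prems(1), of "\<lambda>q. poly q 0"] U V by (simp add: cd)
    moreover have "c ^ n \<noteq> 0" using less.prems cd by auto
    ultimately have "[:d ^ n:] * U = [:d ^ n:] * V" "[:d ^ n:] \<noteq> 0"
      using less.prems(1) by (simp_all add: cd poly_const_pow mult.commute[of _ "[:_:]"])
    thus ?thesis by (metis mult_cancel_left)
  next
    case False
    then obtain x where x: "poly a x = 0 \<or> poly b x = 0"
      using alg_closed_imp_poly_has_root by blast
    have "Polynomial.order x (U * a ^ n) = Polynomial.order x U + n * Polynomial.order x a"
         "Polynomial.order x (V * b ^ n) = Polynomial.order x V + n * Polynomial.order x b"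
      using UV less.prems(2,3) by (simp_all add: order_mult order_power_eq)
    hence ord: "Polynomial.order x U + n * Polynomial.order x a = Polynomial.order x V + n * Polynomial.order x b"
      using less.prems(1) by simp
    have "Polynomial.order x a = Polynomial.order x b"
    proof -
      have "(Polynomial.order x U + n * Polynomial.order x a) div n = Polynomial.order x a"
           "(Polynomial.order x V + n * Polynomial.order x b) div n = Polynomial.order x b"
        using U(2)[of x] V(2)[of x] by auto
      thus ?thesis using ord by simp
    qed
    hence "poly a x = 0" "poly b x = 0"
      using x less.prems order_root by metis+
    then obtain a' b' where ab: "a = [:-x, 1:] * a'" "b = [:-x, 1:] * b'"
      by (auto simp: poly_eq_0_iff_dvd elim!: dvdE)
    have "a' \<noteq> 0" "b' \<noteq> 0" using ab less.prems by auto
    moreover have "degree a' + degree b' < degree a + degree b"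
      using \<open>a' \<noteq> 0\<close> \<open>b' \<noteq> 0\<close> unfolding ab by (simp add: degree_mult_eq del: mult_pCons_left)
    moreover have "U * a' ^ n = V * b' ^ n"
    proof -
      have "[:-x, 1:] ^ n * (U * a' ^ n) = [:-x, 1:] ^ n * (V * b' ^ n)"
        using less.prems(1) unfolding ab power_mult_distrib by (simp only: mult_ac)
      thus ?thesis by (subst (asm) mult_cancel_left) simp
    qed
    ultimately show ?thesis
      using less.hyps by blast
  qed
qed

text \<open>The Euler operator \<open>z d/dz + s\<close>, written in the coordinate \<open>z - \<alpha>\<close>.\<close>

definition euler_op :: "'a::idom \<Rightarrow> 'a \<Rightarrow> 'a poly \<Rightarrow> 'a poly" where
  "euler_op \<alpha> s Q = [:\<alpha>, 1:] * pderiv Q + smult s Q"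

lemma coeff_euler_op:
  "coeff (euler_op \<alpha> s Q) m = \<alpha> * of_nat (Suc m) * coeff Q (Suc m) + (of_nat m + s) * coeff Q m"
  by (cases m) (simp_all add: euler_op_def coeff_pderiv algebra_simps)

text \<open>Chain rule for the substitution of \<open>z + \<alpha>\<close>. The operator at 0 is
  diagonal on monomials, which suits the differential equation; the one at \<open>\<alpha>\<close>
  suits vanishing orders.\<close>

lemma euler_op_pcompose:
  fixes P :: "'a::idom poly"
  shows "(euler_op \<alpha> s ^^ j) (pcompose P [:\<alpha>, 1:]) = pcompose ((euler_op 0 s ^^ j) P) [:\<alpha>, 1:]"
proof (induction j)
  case (Suc j)
  have "euler_op \<alpha> s (pcompose Q [:\<alpha>, 1:]) = pcompose (euler_op 0 s Q) [:\<alpha>, 1:]" for Q :: "'a poly"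
    by (simp add: euler_op_def pcompose_add pcompose_mult pcompose_smult pderiv_pcompose
          pderiv_pCons pcompose_pCons)
  thus ?case by (simp add: Suc)
qed simp

lemma coeff_euler_op_0: "coeff ((euler_op 0 s ^^ j) P) m = (of_nat m + s) ^ j * coeff P m"
  by (induction j) (simp_all add: coeff_euler_op mult.assoc)

context
  fixes Q :: "'a::idom poly" and k :: nat
  assumes low: "\<And>m. m < k \<Longrightarrow> coeff Q m = 0"
begin

lemma coeff_euler_op_low: "m + j < k \<Longrightarrow> coeff ((euler_op \<alpha> s ^^ j) Q) m = 0"
  by (induction j arbitrary: m) (simp_all add: low coeff_euler_op)

text \<open>Each application lowers the vanishing order by at most one, and the lowest coefficient
  comes from \<open>\<alpha>\<close> times the derivative alone, hence the falling factorial and the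
  independence of \<open>s\<close>.\<close>

lemma coeff_euler_op_lead:
  "j \<le> k \<Longrightarrow> coeff ((euler_op \<alpha> s ^^ j) Q) (k - j) = \<alpha> ^ j * of_nat (\<Prod>i<j. k - i) * coeff Q k"
proof (induction j)
  case (Suc j)
  hence *: "Suc (k - Suc j) = k - j" by simp
  have "coeff ((euler_op \<alpha> s ^^ j) Q) (k - Suc j) = 0"
    using Suc.prems by (intro coeff_euler_op_low) simp
  thus ?case
    using Suc by (simp add: coeff_euler_op * algebra_simps del: of_nat_Suc)
qed simp

text \<open>The next coefficient also involves coefficient \<open>k + 1\<close> of \<open>Q\<close>,
  which cancels in the difference to \<open>s = 0\<close>.\<close>

lemma coeff_euler_op_second:
  assumes "Suc j \<le> k"
  shows "coeff ((euler_op \<alpha> s ^^ Suc j) Q) (k - j) - coeff ((euler_op \<alpha> 0 ^^ Suc j) Q) (k - j) =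
     s * of_nat (Suc j) * \<alpha> ^ j * of_nat (\<Prod>i<j. k - i) * coeff Q k"
  using assms
proof (induction j)
  case 0
  thus ?case by (simp add: coeff_euler_op algebra_simps)
next
  case (Suc j)
  define x where "x s = coeff ((euler_op \<alpha> s ^^ Suc j) Q)" for s
  have *: "Suc (k - Suc j) = k - j" using Suc.prems by simp
  have lead: "x t (k - Suc j) = \<alpha> ^ Suc j * of_nat (\<Prod>i<Suc j. k - i) * coeff Q k" for t
    unfolding x_def using Suc.prems by (intro coeff_euler_op_lead) simp
  have "coeff ((euler_op \<alpha> s ^^ Suc (Suc j)) Q) (k - Suc j)
        - coeff ((euler_op \<alpha> 0 ^^ Suc (Suc j)) Q) (k - Suc j)
      = \<alpha> * of_nat (k - j) * (x s (k - j) - x 0 (k - j)) + s * x 0 (k - Suc j)"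
    unfolding funpow.simps(2)[of "Suc j"] o_apply coeff_euler_op * x_def[symmetric]
    by (simp add: lead algebra_simps)
  also have "x s (k - j) - x 0 (k - j) =
      s * of_nat (Suc j) * \<alpha> ^ j * of_nat (\<Prod>i<j. k - i) * coeff Q k"
    unfolding x_def using Suc by simp
  finally show ?case
    unfolding lead prod.lessThan_Suc of_nat_mult power_Suc
    by (simp add: algebra_simps del: funpow.simps of_nat_prod of_nat_diff)
qed

end

section \<open>Differential equation of the truncations and multiplicities of their roots\<close>

context
  fixes h :: nat
  assumes prime_char: "prime CHAR('a::field)" and h: "CHAR('a) = 2 * h + 1"
begin

lemma two_neq_0: "(2 :: 'a) \<noteq> 0"
proof
  assume "(2 :: 'a) = 0"
  hence "CHAR('a) dvd 2" using of_nat_eq_0_iff_char_dvd[where ?'a = 'a, of 2] by simp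
  hence "CHAR('a) \<le> 2" by (rule dvd_imp_le) simp
  thus False using h prime_gt_1_nat[OF prime_char] by simp
qed

text \<open>With \<open>D = z d/dz\<close> this is \<open>D^r g = 4^r z (D + 1/2)^r g\<close>. It
  survives truncation because the boundary term at \<open>n = p\<close> contains
  \<open>central_binom (p - 1)\<close>, which is 0 modulo \<open>p\<close>.\<close>

lemma central_poly_ode:
  assumes "r > 0"
  shows "(euler_op 0 0 ^^ r) (central_poly r :: 'a poly) =
    smult (4 ^ r) ([:0, 1:] * (euler_op 0 (1 / 2) ^^ r) (central_poly r))"
proof (rule poly_eqI)
  fix n
  show "coeff ((euler_op 0 0 ^^ r) (central_poly r :: 'a poly)) n =
    coeff (smult (4 ^ r) ([:0, 1:] * (euler_op 0 (1 / 2) ^^ r) (central_poly r))) n"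
  proof (cases n)
    case 0
    thus ?thesis using assms by (simp add: coeff_euler_op_0)
  next
    case (Suc m)
    have "(4 :: 'a) = 2 * 2" by simp
    hence four: "4 * (of_nat m + 1 / 2) = (of_nat (2 * (2 * m + 1)) :: 'a)"
      using two_neq_0 by (simp add: field_simps)
    have "4 ^ r * ((of_nat m + 1 / 2) ^ r * coeff (central_poly r) m) =
          (of_nat (2 * (2 * m + 1)) :: 'a) ^ r * coeff (central_poly r) m"
      unfolding four[symmetric] power_mult_distrib by simp
    also have "\<dots> = of_nat n ^ r * coeff (central_poly r) n"
    proof -
      consider "n < CHAR('a)" | "n = CHAR('a)" | "n > CHAR('a)" by linarith
      thus ?thesis
      proof cases
        case 1
        have "of_nat (2 * (2 * m + 1)) * of_nat (central_binom m) =
              (of_nat n * of_nat (central_binom n) :: 'a)"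
          unfolding Suc of_nat_mult[symmetric] central_binom_Suc ..
        thus ?thesis
          using 1 Suc by (simp add: coeff_central_poly flip: power_mult_distrib)
      next
        case 2
        hence "h < m" "m < CHAR('a)" using Suc h prime_gt_1_nat[OF prime_char] by auto
        hence "of_nat (central_binom m) = (0 :: 'a)"
          using central_binom_eq_0[OF prime_char h] by blast
        thus ?thesis
          using 2 assms by (simp add: coeff_central_poly power_0_left)
      next
        case 3
        thus ?thesis using Suc by (simp add: coeff_central_poly)
      qed
    qed
    finally show ?thesis
      by (simp add: Suc coeff_euler_op_0)
  qed
qed

lemma order_central_poly:
  assumes r: "r \<ge> 2"
  shows "Polynomial.order \<alpha> (central_poly r :: 'a poly) < r"
proof (rule ccontr)
  let ?B = "central_poly r :: 'a poly"
  define k where "k = Polynomial.order \<alpha> ?B"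
  assume "\<not> Polynomial.order \<alpha> ?B < r"
  hence kr: "r \<le> k" by (simp add: k_def)
  have B0: "poly ?B 0 = 1"
    using prime_gt_0_nat[OF prime_char] by (simp add: poly_0_coeff_0 coeff_central_poly)
  hence Bnz: "?B \<noteq> 0" by auto
  have \<alpha>: "\<alpha> \<noteq> 0"
    using B0 kr r order_0I[of ?B 0] by (auto simp: k_def)
  have kh: "k \<le> h"
    using order_degree[OF Bnz, of \<alpha>] degree_central_poly[OF prime_char h, of r] r by (simp add: k_def)
  obtain q where q: "?B = [:-\<alpha>, 1:] ^ k * q" "\<not> [:-\<alpha>, 1:] dvd q"
    using order_decomp[OF Bnz, of \<alpha>] by (auto simp: k_def)
  \<comment> \<open>The coefficients of \<open>Q\<close> are those of the expansion in powers of
    \<open>z - \<alpha>\<close>; the first nonzero one has index \<open>k\<close>.\<close>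
  define Q where "Q = pcompose ?B [:\<alpha>, 1:]"
  have pcompose_power: "pcompose (u ^ i) v = pcompose u v ^ i" for u v :: "'a poly" and i
    by (induction i) (simp_all add: pcompose_mult one_pCons pcompose_const)
  have Q: "Q = monom 1 k * pcompose q [:\<alpha>, 1:]"
    unfolding Q_def q(1) by (simp add: pcompose_mult pcompose_power pcompose_pCons monom_altdef)
  have low: "coeff Q m = 0" if "m < k" for m
    using that by (simp add: Q coeff_monom_mult)
  have "coeff Q k = poly q \<alpha>"
    by (simp add: Q coeff_monom_mult flip: poly_0_coeff_0) (simp add: poly_pcompose)
  hence c: "coeff Q k \<noteq> 0"
    using q(2) by (simp add: poly_eq_0_iff_dvd)
  \<comment> \<open>Falling factorials of \<open>k\<close>; for \<open>j \<le> r\<close> their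
    factors lie between 1 and \<open>h\<close>, hence are nonzero modulo \<open>p\<close>.\<close>
  define ff where "ff j = (of_nat (\<Prod>i<j. k - i) :: 'a)" for j
  have of_nat_nz: "(of_nat m :: 'a) \<noteq> 0" if "m > 0" "m < CHAR('a)" for m
    using that by (auto simp: of_nat_eq_0_iff_char_dvd dest: dvd_imp_le)
  have ff: "ff j \<noteq> 0" if "j \<le> r" for j
  proof -
    have "\<forall>i<j. of_nat (k - i) \<noteq> (0 :: 'a)"
      using that kr kh h by (intro allI impI of_nat_nz) auto
    thus ?thesis
      unfolding ff_def of_nat_prod by (simp del: of_nat_diff)
  qed
  obtain r' where r': "r = Suc r'" using r by (cases r) auto
  \<comment> \<open>Let \<open>t = z - \<alpha>\<close>. If \<open>k \<ge> r\<close>, the coefficient of \<open>t\<^sup>k\<^sup>-\<^sup>r\<close> in the differential equation gives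
    \<open>\<alpha> = 4\<^sup>-\<^sup>r\<close>, and then that of \<open>t\<^sup>k\<^sup>-\<^sup>r\<^sup>+\<^sup>1\<close> gives \<open>2 k = r - 2\<close> in \<open>'a\<close>, which \<open>2 k < p\<close> excludes.\<close>
  define x where "x s = coeff ((euler_op \<alpha> s ^^ r) Q)" for s
  have lead: "x s (k - r) = \<alpha> ^ r * ff r * coeff Q k" for s
    unfolding x_def ff_def by (rule coeff_euler_op_lead[OF low kr])
  have second: "x s (k - r') - x 0 (k - r') = s * of_nat r * \<alpha> ^ r' * ff r' * coeff Q k" for s
    unfolding x_def ff_def r' using kr by (intro coeff_euler_op_second[OF low]) (simp_all add: r')
  have "(euler_op \<alpha> 0 ^^ r) Q = smult (4 ^ r) ([:\<alpha>, 1:] * (euler_op \<alpha> (1 / 2) ^^ r) Q)"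
    unfolding Q_def euler_op_pcompose using r
    by (subst central_poly_ode) (simp_all add: pcompose_smult pcompose_mult pcompose_pCons)
  hence ode: "x 0 m = 4 ^ r * (\<alpha> * x (1 / 2) m + (if m = 0 then 0 else x (1 / 2) (m - 1)))" for m
    unfolding x_def by (cases m) simp_all
  have "(if k - r = 0 then 0 else x (1 / 2) (k - r - 1)) = 0"
    unfolding x_def by (auto intro!: coeff_euler_op_low[OF low])
  with ode[of "k - r"] have "\<alpha> ^ r * ff r * coeff Q k = 4 ^ r * (\<alpha> * (\<alpha> ^ r * ff r * coeff Q k))"
    unfolding lead by simp
  hence \<alpha>4: "4 ^ r * \<alpha> = 1"
    using \<alpha> c ff[of r] by simp
  have *: "k - r' = Suc (k - r)" using kr r' by simp
  have "x 0 (k - r') = (4 ^ r * \<alpha>) * x (1 / 2) (k - r') + 4 ^ r * x (1 / 2) (k - r)"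
    by (subst ode) (simp add: * algebra_simps)
  hence "0 = (x (1 / 2) (k - r') - x 0 (k - r')) + 4 ^ r * x (1 / 2) (k - r)"
    unfolding \<alpha>4 by simp
  also have "4 ^ r * x (1 / 2) (k - r) = (4 ^ r * \<alpha>) * (\<alpha> ^ r' * ff r * coeff Q k)"
    unfolding lead by (simp add: r' mult_ac)
  also have "ff r = of_nat (k - r') * ff r'"
    unfolding ff_def r' by (simp add: mult.commute)
  finally have "0 = (1 / 2 * of_nat r + of_nat (k - r')) * (\<alpha> ^ r' * ff r' * coeff Q k)"
    unfolding second \<alpha>4 by (simp add: algebra_simps)
  hence "1 / 2 * of_nat r + of_nat (k - r') = (0 :: 'a)"
    using \<alpha> c ff[of r'] r' by simp
  hence zero: "of_nat (r + 2 * (k - r')) = (0 :: 'a)"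
    using two_neq_0 by (simp add: field_simps)
  \<comment> \<open>The number is \<open>2 k - r + 2\<close>: positive because
    \<open>r \<le> k\<close>, and at most \<open>2 h < p\<close> because \<open>r \<ge> 2\<close>
    and \<open>k \<le> h\<close>.\<close>
  have "r + 2 * (k - r') > 0" "r + 2 * (k - r') < CHAR('a)"
    using kr kh h r r' by auto
  from of_nat_nz[OF this] zero show False by contradiction
qed

end

section \<open>Frobenius and linear relations\<close>

text \<open>In a shortest relation between solutions \<open>g\<close> of \<open>g = R g\<^sup>p\<close>, comparing the relation with
  its \<open>p\<close>-th power forces the quotient of two of the solutions to be rational up to a constant.\<close>

lemma frobenius_relation:
  fixes G :: "'e \<Rightarrow> 'a::field fps" and R a :: "'e \<Rightarrow> 'a poly"
  assumes prime_char: "prime CHAR('a)" and fin: "finite S"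
    and R: "\<And>e. e \<in> S \<Longrightarrow> R e \<noteq> 0" and G: "\<And>e. e \<in> S \<Longrightarrow> G e \<noteq> 0"
    and frob: "\<And>e. e \<in> S \<Longrightarrow> G e = G e ^ CHAR('a) * fps_of_poly (R e)"
    and rel: "(\<Sum>e\<in>S. fps_of_poly (a e) * G e) = 0" and nz: "\<exists>e\<in>S. a e \<noteq> 0"
  shows "\<exists>e\<in>S. \<exists>e'\<in>S. e \<noteq> e' \<and>
           (\<exists>x y. x \<noteq> 0 \<and> y \<noteq> 0 \<and> R e * x ^ (CHAR('a) - 1) = R e' * y ^ (CHAR('a) - 1))"
  using rel nz
proof (induction "card {e \<in> S. a e \<noteq> 0}" arbitrary: a rule: less_induct)
  case less
  let ?p = "CHAR('a)"
  obtain q where q: "?p = Suc q" using prime_gt_0_nat[OF prime_char] by (cases ?p) auto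
  obtain e0 where e0: "e0 \<in> S" "a e0 \<noteq> 0" using less.prems by blast
  \<comment> \<open>A common denominator: division by \<open>R e\<close> becomes multiplication by
    \<open>Rh e\<close>.\<close>
  define RS where "RS = (\<Prod>e\<in>S. R e)"
  define Rh where "Rh e = (\<Prod>i\<in>S - {e}. R i)" for e
  have RS: "RS = R e * Rh e" if "e \<in> S" for e
    unfolding RS_def Rh_def using fin that by (rule prod.remove)
  have RSnz: "RS \<noteq> 0" unfolding RS_def using R fin by simp
  \<comment> \<open>The combination of the relation with its Frobenius twist in which the
    coefficient at \<open>e0\<close> cancels.\<close>
  define b where "b e = a e0 ^ ?p * Rh e0 * a e - a e0 * (a e ^ ?p * Rh e)" for e
  \<comment> \<open>The twist is the \<open>p\<close>-th power of the relation with
    \<open>G e ^ p\<close> replaced by \<open>G e / R e\<close>.\<close>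
  have "(\<Sum>e\<in>S. fps_of_poly (a e ^ ?p * Rh e) * G e) = fps_of_poly RS * (\<Sum>e\<in>S. (fps_of_poly (a e) * G e) ^ ?p)"
    unfolding sum_distrib_left
  proof (rule sum.cong)
    fix e assume e: "e \<in> S"
    have "fps_of_poly (a e ^ ?p * Rh e) * G e =
        fps_of_poly (a e ^ ?p * Rh e) * (G e ^ ?p * fps_of_poly (R e))"
      using frob[OF e] by simp
    thus "fps_of_poly (a e ^ ?p * Rh e) * G e = fps_of_poly RS * (fps_of_poly (a e) * G e) ^ ?p"
      by (simp add: RS[OF e] fps_of_poly_mult fps_of_poly_power power_mult_distrib mult_ac)
  qed simp
  also have "(\<Sum>e\<in>S. (fps_of_poly (a e) * G e) ^ ?p) = (\<Sum>e\<in>S. fps_of_poly (a e) * G e) ^ ?p"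
    by (rule freshmans_dream_sum[symmetric]) (use prime_char in auto)
  also have "\<dots> = 0" by (simp add: less.prems(1) q)
  finally have frob_rel: "(\<Sum>e\<in>S. fps_of_poly (a e ^ ?p * Rh e) * G e) = 0" by simp
  have "(\<Sum>e\<in>S. fps_of_poly (b e) * G e) =
      fps_of_poly (a e0 ^ ?p * Rh e0) * (\<Sum>e\<in>S. fps_of_poly (a e) * G e)
      - fps_of_poly (a e0) * (\<Sum>e\<in>S. fps_of_poly (a e ^ ?p * Rh e) * G e)"
    by (simp add: b_def fps_of_poly_diff fps_of_poly_mult left_diff_distrib sum_subtractf
          sum_distrib_left mult.assoc)
  hence b_rel: "(\<Sum>e\<in>S. fps_of_poly (b e) * G e) = 0"
    by (simp only: less.prems(1) frob_rel) simp
  show ?case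
  proof (cases "\<exists>e\<in>S. b e \<noteq> 0")
    case True
    have "b e0 = 0" unfolding b_def by (simp add: q algebra_simps)
    moreover have "b e = 0" if "a e = 0" for e
      using that by (simp add: b_def q)
    ultimately have "{e \<in> S. b e \<noteq> 0} \<subset> {e \<in> S. a e \<noteq> 0}"
      using e0 by auto
    hence "card {e \<in> S. b e \<noteq> 0} < card {e \<in> S. a e \<noteq> 0}"
      using fin by (intro psubset_card_mono) auto
    thus ?thesis using less.hyps b_rel True by blast
  next
    case False
    \<comment> \<open>A single nonzero coefficient would force \<open>G e0 = 0\<close>. For a second
      index \<open>e1\<close>, the equation \<open>b e1 = 0\<close> becomes the desired identity
      after cancellation.\<close>
    have "\<exists>e1\<in>S. e1 \<noteq> e0 \<and> a e1 \<noteq> 0"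
    proof (rule ccontr)
      assume "\<not> ?thesis"
      hence "(\<Sum>e\<in>S. fps_of_poly (a e) * G e) = (\<Sum>e\<in>{e0}. fps_of_poly (a e) * G e)"
        using fin e0 by (intro sum.mono_neutral_right) auto
      thus False using less.prems(1) e0 G by simp
    qed
    then obtain e1 where e1: "e1 \<in> S" "e1 \<noteq> e0" "a e1 \<noteq> 0" by blast
    have "a e0 ^ ?p * Rh e0 * a e1 = a e0 * (a e1 ^ ?p * Rh e1)"
      using False e1(1) by (simp add: b_def)
    hence "(a e0 * a e1) * (a e0 ^ q * Rh e0) = (a e0 * a e1) * (a e1 ^ q * Rh e1)"
      by (simp add: q mult_ac)
    hence *: "a e0 ^ q * Rh e0 = a e1 ^ q * Rh e1"
      using e0 e1 by simp
    have "RS * (R e1 * a e0 ^ q) = R e0 * R e1 * (a e0 ^ q * Rh e0)"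
      by (simp add: RS[OF e0(1)] mult_ac)
    also have "\<dots> = RS * (R e0 * a e1 ^ q)"
      unfolding * by (simp add: RS[OF e1(1)] mult_ac)
    finally have "R e1 * a e0 ^ q = R e0 * a e1 ^ q"
      using RSnz by simp
    thus ?thesis using e0 e1 q by auto
  qed
qed

lemma fps_prod_frobenius:
  fixes F G :: "'b \<Rightarrow> 'a::field fps"
  assumes "\<And>i. i \<in> I \<Longrightarrow> F i = G i ^ p * fps_of_poly (A i)"
  shows "(\<Prod>i\<in>I. F i ^ e i) = (\<Prod>i\<in>I. G i ^ e i) ^ p * fps_of_poly (\<Prod>i\<in>I. A i ^ e i)"
proof -
  have "(\<Prod>i\<in>I. F i ^ e i) = (\<Prod>i\<in>I. (G i ^ p * fps_of_poly (A i)) ^ e i)"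
    by (rule prod.cong) (auto simp: assms)
  thus ?thesis
    by (simp add: power_mult_distrib prod.distrib prod_power_distrib fps_of_poly_prod
          fps_of_poly_power mult.commute flip: power_mult)
qed

text \<open>Each monomial in the \<open>frakf_fps i\<close> is \<open>A e * G e ^ p\<close>, and
  \<open>G e ^ p = G e / R e\<close>, so the relation is linear in the \<open>G e\<close> and
  \<open>frobenius_relation\<close> applies. The assumption \<open>bound\<close> keeps the root
  multiplicities of \<open>R e\<close> below \<open>p - 1\<close>, so the powers can be stripped
  off.\<close>

lemma central_poly_products_eq:
  fixes S :: "(nat \<Rightarrow> nat) set" and C :: "(nat \<Rightarrow> nat) \<Rightarrow> 'a::alg_closed_field poly"
  assumes prime_char: "prime CHAR('a)" and h: "CHAR('a) = 2 * h + 1"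
    and fin: "finite S"
    and rel: "(\<Sum>e\<in>S. fps_of_poly (C e) * (\<Prod>i\<in>{2..l}. frakf_fps i ^ e i)) = 0"
    and nz: "\<exists>e\<in>S. C e \<noteq> 0"
    and bound: "\<And>e. e \<in> S \<Longrightarrow> l * (\<Sum>i\<in>{2..l}. e i) < CHAR('a) - 1"
  shows "\<exists>e\<in>S. \<exists>e'\<in>S. e \<noteq> e' \<and>
     (\<Prod>i\<in>{2..l}. central_poly i ^ e i) = (\<Prod>i\<in>{2..l}. central_poly i ^ e' i :: 'a poly)"
proof -
  let ?p = "CHAR('a)"
  define G where "G e = (\<Prod>i\<in>{2..l}. central_fps i ^ e i :: 'a fps)" for e
  define R where "R e = (\<Prod>i\<in>{2..l}. central_poly i ^ e i :: 'a poly)" for e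
  define A where "A e = (\<Prod>i\<in>{2..l}. frakf_poly i ^ e i :: 'a poly)" for e
  have pos: "?p > 0" using h by simp
  have B0: "poly (central_poly i) 0 = (1 :: 'a)" for i
    using pos by (simp add: poly_0_coeff_0 coeff_central_poly)
  have A0: "poly (frakf_poly i) 0 = (1 :: 'a)" for i
    using pos by (simp add: poly_0_coeff_0 coeff_frakf_poly)
  have R0: "poly (R e) 0 = 1" for e by (simp add: R_def poly_prod B0)
  have Rnz: "R e \<noteq> 0" for e using R0[of e] by auto
  have "poly (A e) 0 = 1" for e by (simp add: A_def poly_prod A0)
  hence Anz: "A e \<noteq> 0" for e by (metis poly_0 zero_neq_one)
  have Gnz: "G e \<noteq> 0" for e
    using central_products_nth_0[where ?'a = 'a, of e "{2..l}"] unfolding G_def by (metis fps_zero_nth zero_neq_one)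
  have G_frob: "G e = G e ^ ?p * fps_of_poly (R e)" for e
    unfolding G_def R_def by (rule fps_prod_frobenius) (rule central_fps_eq[OF prime_char h])
  have frakf: "(\<Prod>i\<in>{2..l}. frakf_fps i ^ e i) = G e ^ ?p * fps_of_poly (A e)" for e
    unfolding G_def A_def by (rule fps_prod_frobenius) (simp add: frakf_fps_eq[OF prime_char h])
  define RS where "RS = (\<Prod>e\<in>S. R e)"
  define a where "a e = C e * A e * (\<Prod>i\<in>S - {e}. R i)" for e
  have "(\<Sum>e\<in>S. fps_of_poly (a e) * G e) =
      fps_of_poly RS * (\<Sum>e\<in>S. fps_of_poly (C e) * (\<Prod>i\<in>{2..l}. frakf_fps i ^ e i))"
    unfolding sum_distrib_left
  proof (rule sum.cong)
    fix e assume e: "e \<in> S"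
    have RS: "RS = R e * (\<Prod>i\<in>S - {e}. R i)"
      unfolding RS_def using fin e by (rule prod.remove)
    have "fps_of_poly (a e) * G e = fps_of_poly (a e) * (G e ^ ?p * fps_of_poly (R e))"
      using G_frob[of e] by simp
    thus "fps_of_poly (a e) * G e =
        fps_of_poly RS * (fps_of_poly (C e) * (\<Prod>i\<in>{2..l}. frakf_fps i ^ e i))"
      by (simp add: frakf a_def RS fps_of_poly_mult mult_ac)
  qed simp
  hence a_rel: "(\<Sum>e\<in>S. fps_of_poly (a e) * G e) = 0" by (simp add: rel)
  have a_nz: "\<exists>e\<in>S. a e \<noteq> 0"
    using nz Rnz Anz fin by (auto simp: a_def)
  obtain e e' x y where e: "e \<in> S" "e' \<in> S" "e \<noteq> e'" "x \<noteq> 0" "y \<noteq> 0"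
      "R e * x ^ (?p - 1) = R e' * y ^ (?p - 1)"
    using frobenius_relation[OF prime_char fin Rnz Gnz G_frob a_rel a_nz] by metis
  have ord: "Polynomial.order z (R e) < ?p - 1" if "e \<in> S" for e z
  proof -
    have nz: "central_poly i \<noteq> (0 :: 'a poly)" for i
      using B0[of i] by auto
    hence "Polynomial.order z (R e) = (\<Sum>i\<in>{2..l}. e i * Polynomial.order z (central_poly i :: 'a poly))"
      by (simp add: R_def order_prod_eq order_power_eq)
    also have "\<dots> \<le> (\<Sum>i\<in>{2..l}. e i * l)"
    proof (intro sum_mono mult_le_mono2)
      fix i assume "i \<in> {2..l}"
      thus "Polynomial.order z (central_poly i :: 'a poly) \<le> l"
        using order_central_poly[OF prime_char h, of i z] by simp
    qed
    also have "\<dots> = l * (\<Sum>i\<in>{2..l}. e i)"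
      by (simp add: sum_distrib_left mult.commute)
    finally show ?thesis using bound[OF that] by simp
  qed
  have "R e = R e'"
    by (rule poly_eq_if_power_multiples_eq[OF R0 ord R0 ord e(6,4,5)]) (use e in auto)
  thus ?thesis using e unfolding R_def by blast
qed

text \<open>In \<open>G = G ^ p * R\<close> the factor \<open>G ^ p\<close> is 1 up to terms from
  \<open>z ^ p\<close> on.\<close>

lemma central_products_nth:
  assumes prime_char: "prime CHAR('a::field)" and h: "CHAR('a) = 2 * h + 1" and n: "n < CHAR('a)"
  shows "fps_nth (\<Prod>i\<in>I. central_fps i ^ e i :: 'a fps) n = coeff (\<Prod>i\<in>I. central_poly i ^ e i) n"
proof -
  let ?p = "CHAR('a)"
  define G where "G = (\<Prod>i\<in>I. central_fps i ^ e i :: 'a fps)"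
  define R where "R = (\<Prod>i\<in>I. central_poly i ^ e i :: 'a poly)"
  have G: "G = G ^ ?p * fps_of_poly R"
    unfolding G_def R_def by (rule fps_prod_frobenius) (rule central_fps_eq[OF prime_char h])
  have G0: "fps_nth G 0 = 1" by (simp add: G_def)
  have "fps_nth G n = (\<Sum>i=0..n. fps_nth (G ^ ?p) i * fps_nth (fps_of_poly R) (n - i))"
    by (subst G, rule fps_mult_nth)
  also have "\<dots> = (\<Sum>i\<in>{0}. fps_nth (G ^ ?p) i * fps_nth (fps_of_poly R) (n - i))"
    by (rule sum.mono_neutral_right)
       (use n in \<open>auto simp: fps_power_CHAR_nth[OF prime_char] dest: dvd_imp_le\<close>)
  also have "\<dots> = coeff R n"
    by (simp add: fps_power_CHAR_nth[OF prime_char] G0)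
  finally show ?thesis unfolding G_def R_def .
qed

section \<open>Growth of coefficients\<close>

text \<open>The polynomial factor absorbs the \<open>n + 1\<close> summands of a convolution, so the
  class is closed under products.\<close>

definition tame_fps :: "int \<Rightarrow> int fps \<Rightarrow> bool" where
  "tame_fps M f \<longleftrightarrow> (\<exists>N. \<forall>n. 0 \<le> fps_nth f n \<and> fps_nth f n \<le> (int n + 1) ^ N * M ^ n)"

lemma tame_fps_1: "M \<ge> 0 \<Longrightarrow> tame_fps M 1"
  unfolding tame_fps_def by (rule exI[of _ 0]) auto

lemma tame_fps_mult:
  assumes M: "M \<ge> 0" and "tame_fps M f" "tame_fps M g"
  shows "tame_fps M (f * g)"
proof -
  obtain a where a: "\<And>n. 0 \<le> fps_nth f n" "\<And>n. fps_nth f n \<le> (int n + 1) ^ a * M ^ n"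
    using assms(2) by (auto simp: tame_fps_def)
  obtain b where b: "\<And>n. 0 \<le> fps_nth g n" "\<And>n. fps_nth g n \<le> (int n + 1) ^ b * M ^ n"
    using assms(3) by (auto simp: tame_fps_def)
  have "fps_nth (f * g) n \<le> (int n + 1) ^ Suc (a + b) * M ^ n" for n
  proof -
    have "fps_nth (f * g) n \<le> (\<Sum>i=0..n. (int n + 1) ^ (a + b) * M ^ n)"
      unfolding fps_mult_nth
    proof (rule sum_mono)
      fix i assume i: "i \<in> {0..n}"
      have "fps_nth f i * fps_nth g (n - i) \<le>
          ((int i + 1) ^ a * M ^ i) * ((int (n - i) + 1) ^ b * M ^ (n - i))"
        using M by (intro mult_mono a b) auto
      also have "\<dots> = ((int i + 1) ^ a * (int (n - i) + 1) ^ b) * M ^ n"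
        using i by (simp add: mult_ac flip: power_add)
      also have "\<dots> \<le> ((int n + 1) ^ a * (int n + 1) ^ b) * M ^ n"
        using i M by (intro mult_right_mono mult_mono power_mono) auto
      finally show "fps_nth f i * fps_nth g (n - i) \<le> (int n + 1) ^ (a + b) * M ^ n"
        by (simp add: power_add)
    qed
    thus ?thesis by (simp add: algebra_simps)
  qed
  moreover have "0 \<le> fps_nth (f * g) n" for n
    unfolding fps_mult_nth by (intro sum_nonneg mult_nonneg_nonneg a b)
  ultimately show ?thesis unfolding tame_fps_def by blast
qed

lemma tame_fps_central_products:
  assumes I: "finite I" and M: "\<And>i. i \<in> I \<Longrightarrow> e i \<noteq> 0 \<Longrightarrow> i \<le> m"
  shows "tame_fps (4 ^ m) (\<Prod>i\<in>I. central_fps i ^ e i)"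
proof -
  have power: "tame_fps (4 ^ m) (f ^ k)" if "k \<noteq> 0 \<Longrightarrow> tame_fps (4 ^ m) f" for f k
    using that by (induction k) (auto intro: tame_fps_1 tame_fps_mult)
  have central: "tame_fps (4 ^ m) (central_fps i)" if "i \<le> m" for i
    unfolding tame_fps_def
  proof (intro exI[of _ 0] allI conjI)
    fix n
    have "central_binom n \<le> 4 ^ n"
      using binomial_le_pow2[of "2 * n" n] by (simp add: central_binom_def power_mult)
    hence "central_binom n ^ i \<le> (4 ^ n) ^ i" by (rule power_mono) simp
    also have "\<dots> \<le> (4 ^ n) ^ m" using that by (intro power_increasing) auto
    also have "\<dots> = (4 ^ m) ^ n" by (simp add: mult.commute flip: power_mult)
    finally have "int (central_binom n ^ i) \<le> int ((4 ^ m) ^ n)" by (simp only: of_nat_le_iff)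
    thus "fps_nth (central_fps i) n \<le> (int n + 1) ^ 0 * (4 ^ m) ^ n"
      by (simp add: central_fps_def)
  qed (simp add: central_fps_def)
  show ?thesis
    using I M by (induction I rule: finite_induct)
      (auto intro!: tame_fps_1 tame_fps_mult power central)
qed

lemma exponential_beats_polynomial:
  assumes "L + N > 0"
  shows "\<exists>n>0. (2 * n) ^ L * (n + 1) ^ N < (4 ^ n :: nat)"
proof -
  define M where "M = L + N"
  \<comment> \<open>Here \<open>n + 1\<close> is a power of 2, and \<open>2 n\<close> and
    \<open>n + 1\<close> are at most \<open>2 ^ (2 M + 1)\<close>. It remains to see
    \<open>(2 M + 1) M < 2 n\<close>, which follows from \<open>(M + 1)^2 \<le> n + 1\<close> and
    \<open>M > 0\<close>.\<close>
  define n where "n = (2 ^ (2 * M) - 1 :: nat)"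
  have "M + 1 \<le> 2 ^ M" using less_exp[of M] by linarith
  hence "(M + 1) * (M + 1) \<le> 2 ^ M * (2 ^ M :: nat)" by (intro mult_le_mono)
  hence n: "n + 1 = 2 ^ (2 * M)" "(M + 1) * (M + 1) \<le> n + 1"
    by (simp_all add: n_def mult_2 power_add)
  have "M > 0" using assms by (simp add: M_def)
  have "(2 * n) ^ L * (n + 1) ^ N \<le> (2 * (n + 1)) ^ L * (2 * (n + 1)) ^ N"
    by (intro mult_le_mono power_mono) auto
  also have "\<dots> = (2 ^ (2 * M + 1)) ^ M"
    unfolding n by (simp add: M_def power_add)
  also have "\<dots> = 2 ^ ((2 * M + 1) * M)" by (simp only: power_mult)
  also have "\<dots> < 2 ^ (2 * n)"
    using n(2) \<open>M > 0\<close> by (intro power_strict_increasing) (auto simp: algebra_simps)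
  also have "\<dots> = 4 ^ n" by (simp add: power_mult)
  finally show ?thesis using n(2) \<open>M > 0\<close> by (intro exI[of _ n]) auto
qed

text \<open>The growth rates differ: for \<open>n > 0\<close> the left coefficients are at least
  \<open>(4 ^ n / (2 n)) ^ L\<close>, the right ones at most a polynomial times
  \<open>4 ^ ((L - 1) n)\<close>.\<close>

lemma central_products_neq_aux:
  fixes u v :: "nat \<Rightarrow> nat"
  assumes I: "finite I" "L \<in> I" "L > 0" and u: "u L > 0" and v: "\<And>i. i \<ge> L \<Longrightarrow> v i = 0"
  shows "(\<Prod>i\<in>I. central_fps i ^ u i :: int fps) \<noteq> (\<Prod>i\<in>I. central_fps i ^ v i)"
proof
  assume eq: "(\<Prod>i\<in>I. central_fps i ^ u i :: int fps) = (\<Prod>i\<in>I. central_fps i ^ v i)"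
  \<comment> \<open>One factor \<open>central_fps L\<close> is split off; the rest \<open>H\<close>
    has constant term 1 and nonnegative coefficients, so it preserves lower bounds.\<close>
  define u' where "u' = u(L := u L - 1)"
  define H where "H = (\<Prod>i\<in>I. central_fps i ^ u' i :: int fps)"
  have "(\<Prod>i\<in>I. central_fps i ^ u i :: int fps) =
      central_fps L ^ u L * (\<Prod>i\<in>I - {L}. central_fps i ^ u i)"
    using I by (intro prod.remove) auto
  also have "(\<Prod>i\<in>I - {L}. central_fps i ^ u i :: int fps) = (\<Prod>i\<in>I - {L}. central_fps i ^ u' i)"
    by (rule prod.cong) (auto simp: u'_def)
  also have "central_fps L ^ u L = (central_fps L * central_fps L ^ u' L :: int fps)"
    using u by (simp add: u'_def flip: power_Suc)
  also have "central_fps L * central_fps L ^ u' L * (\<Prod>i\<in>I - {L}. central_fps i ^ u' i) =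
      central_fps L * H"
    unfolding H_def using I by (simp add: prod.remove[of I L] mult.assoc)
  finally have uH: "(\<Prod>i\<in>I. central_fps i ^ v i) = central_fps L * H" by (simp add: eq)
  have "\<exists>m. \<forall>i\<in>I. i \<le> m"
    using I(1) by (meson Max_ge)
  then obtain m where "\<And>i. i \<in> I \<Longrightarrow> i \<le> m" by blast
  hence "tame_fps (4 ^ m) H"
    unfolding H_def by (intro tame_fps_central_products I) auto
  hence H: "fps_nth H n \<ge> 0" for n by (auto simp: tame_fps_def)
  have lower: "int (central_binom n) ^ L \<le> fps_nth (\<Prod>i\<in>I. central_fps i ^ v i) n" for n
  proof -
    have "int (central_binom n) ^ L = fps_nth (central_fps L) n * fps_nth H (n - n)"
      unfolding H_def diff_self_eq_0 central_products_nth_0 by (simp add: central_fps_def)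
    also have "\<dots> \<le> (\<Sum>i=0..n. fps_nth (central_fps L) i * fps_nth H (n - i))"
      by (rule member_le_sum) (auto intro!: mult_nonneg_nonneg H simp: central_fps_def)
    finally show ?thesis by (simp add: uH fps_mult_nth)
  qed
  have "tame_fps (4 ^ (L - 1)) (\<Prod>i\<in>I. central_fps i ^ v i)"
  proof (rule tame_fps_central_products[OF I(1)])
    fix i assume "v i \<noteq> 0"
    hence "i < L" using v[of i] by force
    thus "i \<le> L - 1" by simp
  qed
  then obtain N where upper:
      "\<And>n. fps_nth (\<Prod>i\<in>I. central_fps i ^ v i) n \<le> (int n + 1) ^ N * (4 ^ (L - 1)) ^ n"
    by (auto simp: tame_fps_def)
  obtain n where n: "n > 0" "(2 * n) ^ L * (n + 1) ^ N < (4 ^ n :: nat)"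
    using exponential_beats_polynomial[of L N] I by auto
  have "int (central_binom n ^ L) \<le> int ((n + 1) ^ N * (4 ^ (L - 1)) ^ n)"
    using order_trans[OF lower[of n] upper[of n]] by (simp add: add.commute)
  hence *: "central_binom n ^ L \<le> (n + 1) ^ N * (4 ^ (L - 1)) ^ n"
    by (simp only: of_nat_le_iff)
  have "real (4 ^ n) \<le> real (2 * n * central_binom n)"
    using central_binomial_lower_bound[OF n(1)] n(1) by (simp add: central_binom_def field_simps)
  hence "4 ^ n \<le> 2 * n * central_binom n" by (simp only: of_nat_le_iff)
  hence "(4 ^ n) ^ L \<le> (2 * n * central_binom n) ^ L" by (rule power_mono) simp
  also have "\<dots> = (2 * n) ^ L * central_binom n ^ L" by (simp only: power_mult_distrib)
  also have "\<dots> \<le> (2 * n) ^ L * ((n + 1) ^ N * (4 ^ (L - 1)) ^ n)"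
    by (intro mult_le_mono2 *)
  also have "\<dots> = ((2 * n) ^ L * (n + 1) ^ N) * (4 ^ (L - 1)) ^ n" by (simp only: mult.assoc)
  also have "\<dots> < 4 ^ n * (4 ^ (L - 1)) ^ n"
    using n(2) by (intro mult_strict_right_mono) auto
  also have "\<dots> = (4 ^ n) ^ L"
    using I(3) by (cases L) (simp_all add: power_mult_distrib mult.commute flip: power_mult)
  finally show False by simp
qed

text \<open>At the largest index \<open>L\<close> where the exponents differ, cancel what both
  products share from \<open>L\<close> upwards; the previous lemma then applies.\<close>

lemma central_products_neq:
  fixes e e' :: "nat \<Rightarrow> nat"
  assumes I: "finite I" "0 \<notin> I" and neq: "e \<noteq> e'"
    and supp: "\<And>i. i \<notin> I \<Longrightarrow> e i = 0" "\<And>i. i \<notin> I \<Longrightarrow> e' i = 0"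
  shows "(\<Prod>i\<in>I. central_fps i ^ e i :: int fps) \<noteq> (\<Prod>i\<in>I. central_fps i ^ e' i)"
proof -
  let ?P = "\<lambda>e. \<Prod>i\<in>I. central_fps i ^ e i :: int fps"
  define D where "D = {i \<in> I. e i \<noteq> e' i}"
  define L where "L = Max D"
  have D: "finite D" "D \<noteq> {}"
    using I(1) neq supp by (auto simp: D_def fun_eq_iff) metis
  hence "L \<in> D" unfolding L_def by (rule Max_in)
  hence L: "L \<in> I" "e L \<noteq> e' L" by (auto simp: D_def)
  hence L0: "L > 0" using I by (cases L) auto
  have above: "e i = e' i" if "i > L" for i
  proof (rule ccontr)
    assume "e i \<noteq> e' i"
    hence "i \<in> D" unfolding D_def using supp by fastforce
    hence "i \<le> L" unfolding L_def using D by simp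
    thus False using that by simp
  qed
  have main: "?P x \<noteq> ?P y" if less: "y L < x L" and xy: "\<And>i. i > L \<Longrightarrow> x i = y i" for x y
  proof
    assume eq: "?P x = ?P y"
    \<comment> \<open>Subtracting \<open>w\<close> leaves \<open>x\<close> a positive exponent at
      \<open>L\<close> and removes all exponents of \<open>y\<close> from \<open>L\<close> on. The
      natural subtractions are exact since \<open>y L < x L\<close>.\<close>
    define w where "w i = (if i < L then 0 else y i)" for i
    have split: "?P (\<lambda>i. w i + t i) = ?P w * ?P t" for t
      by (simp add: power_add prod.distrib)
    have w: "w i + (x i - w i) = x i" "w i + (y i - w i) = y i" for i
      using less xy[of i] by (cases i L rule: linorder_cases; simp add: w_def)+
    have "?P w * ?P (\<lambda>i. x i - w i) = ?P w * ?P (\<lambda>i. y i - w i)"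
      using eq split[of "\<lambda>i. x i - w i"] split[of "\<lambda>i. y i - w i"] by (simp only: w)
    moreover have "?P w \<noteq> 0"
      using central_products_nth_0[where ?'a = int, of w I] by (metis fps_zero_nth zero_neq_one)
    ultimately have "?P (\<lambda>i. x i - w i) = ?P (\<lambda>i. y i - w i)" by simp
    moreover have "?P (\<lambda>i. x i - w i) \<noteq> ?P (\<lambda>i. y i - w i)"
      by (rule central_products_neq_aux[of I L]) (use I L L0 less in \<open>auto simp: w_def\<close>)
    ultimately show False by contradiction
  qed
  show ?thesis
  proof (cases "e L < e' L")
    case True
    thus ?thesis using main[of e e'] above by metis
  next
    case False
    thus ?thesis using main[of e' e] above L(2) by simp
  qed
qed

section \<open>Reduction modulo a prime\<close>

text \<open>By cross multiplication the quotient does not depend on the chosen fraction, so the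
  description is unique.\<close>

lemma ratfun_to_fls_Fract:
  assumes "b \<noteq> 0"
  shows "ratfun_to_fls (Fract a b) = fps_to_fls (fps_of_poly a) / fps_to_fls (fps_of_poly b)"
  unfolding ratfun_to_fls_def
proof (rule the_equality)
  show "\<exists>a' b'. b' \<noteq> 0 \<and> Fract a b = Fract a' b' \<and>
      fps_to_fls (fps_of_poly a) / fps_to_fls (fps_of_poly b) =
      fps_to_fls (fps_of_poly a') / fps_to_fls (fps_of_poly b')"
    using assms by blast
next
  fix y assume "\<exists>a' b'. b' \<noteq> 0 \<and> Fract a b = Fract a' b' \<and>
      y = fps_to_fls (fps_of_poly a') / fps_to_fls (fps_of_poly b')"
  then obtain a' b' where b': "b' \<noteq> 0" "a * b' = a' * b"
      "y = fps_to_fls (fps_of_poly a') / fps_to_fls (fps_of_poly b')"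
    using assms by (auto simp: eq_fract)
  have "fps_to_fls (fps_of_poly a) * fps_to_fls (fps_of_poly b') =
      fps_to_fls (fps_of_poly a') * fps_to_fls (fps_of_poly b)"
    using b'(2) by (simp flip: fls_times_fps_to_fls fps_of_poly_mult)
  thus "y = fps_to_fls (fps_of_poly a) / fps_to_fls (fps_of_poly b)"
    using assms b'(1) by (simp add: b'(3) frac_eq_eq)
qed

section \<open>Clearing denominators in an algebraic relation\<close>

lemma fps_to_fls_sum: "fps_to_fls (\<Sum>x\<in>A. f x) = (\<Sum>x\<in>A. fps_to_fls (f x))"
  by (induction A rule: infinite_finite_induct) simp_all

lemma fps_to_fls_prod:
  "fps_to_fls (\<Prod>x\<in>A. f x :: 'a::comm_ring_1 fps) = (\<Prod>x\<in>A. fps_to_fls (f x))"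
  by (induction A rule: infinite_finite_induct) (simp_all add: fls_times_fps_to_fls)

lemma finite_common_denominator:
  fixes A :: "rat set"
  assumes "finite A"
  shows "\<exists>d::int. d \<noteq> 0 \<and> (\<forall>x\<in>A. of_int d * x \<in> \<int>)"
  using assms
proof (induction A rule: finite_induct)
  case empty
  show ?case by (rule exI[of _ 1]) simp
next
  case (insert x A)
  then obtain d :: int where d: "d \<noteq> 0" "\<forall>x\<in>A. of_int d * x \<in> \<int>" by blast
  obtain a b where x: "x = of_int a / of_int b" "b > 0"
    by (metis quotient_of_div quotient_of_denom_pos surj_pair)
  have "of_int (b * d) * y \<in> \<int>" if "y \<in> insert x A" for y
  proof (cases "y = x")
    case True
    hence "of_int (b * d) * y = of_int (d * a)" using x by simp
    thus ?thesis by (simp only: Ints_of_int)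
  next
    case False
    hence "of_int b * (of_int d * y) \<in> \<int>" using that d by auto
    thus ?thesis by (simp add: mult.assoc)
  qed
  thus ?case using d x by (intro exI[of _ "b * d"]) auto
qed

definition frakf_relation ::
    "nat \<Rightarrow> (nat \<Rightarrow> nat) set \<Rightarrow> ((nat \<Rightarrow> nat) \<Rightarrow> int poly) \<Rightarrow> bool" where
  "frakf_relation l S C \<longleftrightarrow> finite S \<and> (\<forall>e\<in>S. \<forall>i. i \<notin> {2..l} \<longrightarrow> e i = 0) \<and>
     (\<Sum>e\<in>S. fps_of_poly (C e) * (\<Prod>i\<in>{2..l}. frakf_fps i ^ e i)) = 0 \<and> (\<exists>e\<in>S. C e \<noteq> 0)"

text \<open>Denominators are cleared twice: the product of the \<open>b e\<close> leads to
  polynomials, then \<open>d\<close> to integer coefficients. Injectivity of the base change to the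
  rationals brings the relation down to the integers.\<close>

lemma frakf_relation_exists:
  assumes "\<not> alg_indep_over_Qz frakf {2..l}"
  shows "\<exists>S C. frakf_relation l S C"
proof -
  obtain S c where fin: "finite S" and supp: "\<forall>e\<in>S. \<forall>i. i \<notin> {2..l} \<longrightarrow> e i = 0"
    and rel: "(\<Sum>e\<in>S. ratfun_to_fls (c e) * (\<Prod>i\<in>{2..l}. fps_to_fls (frakf i) ^ e i)) = 0"
    and nz: "\<exists>e\<in>S. c e \<noteq> 0"
    using assms unfolding alg_indep_over_Qz_def by blast
  have "\<forall>e. \<exists>a b. c e = Fract a b \<and> b \<noteq> 0" by (metis Fract_cases)
  then obtain a b where ab: "\<And>e. c e = Fract (a e) (b e)" "\<And>e. b e \<noteq> 0" by metis
  define P where "P e = a e * (\<Prod>i\<in>S - {e}. b i)" for e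
  define M where "M e = (\<Prod>i\<in>{2..l}. frakf_fps i ^ e i :: rat fps)" for e
  have "fps_to_fls (\<Sum>e\<in>S. fps_of_poly (P e) * M e) =
      fps_to_fls (fps_of_poly (\<Prod>i\<in>S. b i)) *
        (\<Sum>e\<in>S. ratfun_to_fls (c e) * (\<Prod>i\<in>{2..l}. fps_to_fls (frakf i) ^ e i))"
    unfolding fps_to_fls_sum sum_distrib_left
  proof (rule sum.cong)
    fix e assume e: "e \<in> S"
    have "(\<Prod>i\<in>{2..l}. fps_to_fls (frakf i) ^ e i) = fps_to_fls (M e)"
      by (simp add: M_def fps_to_fls_prod fps_to_fls_power frakf_eq)
    moreover have "(\<Prod>i\<in>S. b i) = b e * (\<Prod>i\<in>S - {e}. b i)"
      using fin e by (rule prod.remove)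
    ultimately show "fps_to_fls (fps_of_poly (P e) * M e) =
        fps_to_fls (fps_of_poly (\<Prod>i\<in>S. b i)) *
          (ratfun_to_fls (c e) * (\<Prod>i\<in>{2..l}. fps_to_fls (frakf i) ^ e i))"
      using ab(2)[of e]
      by (simp add: P_def ab(1) ratfun_to_fls_Fract fps_of_poly_mult fls_times_fps_to_fls)
  qed simp
  hence ratrel: "(\<Sum>e\<in>S. fps_of_poly (P e) * M e) = 0"
    by (simp add: rel)
  have Pnz: "\<exists>e\<in>S. P e \<noteq> 0"
  proof -
    obtain e where e: "e \<in> S" "c e \<noteq> 0" using nz by blast
    hence "a e \<noteq> 0" by (auto simp: ab(1) fract_collapse)
    thus ?thesis using e(1) ab(2) fin by (auto simp: P_def)
  qed
  have "finite (\<Union>e\<in>S. set (coeffs (P e)))" using fin by simp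
  from finite_common_denominator[OF this]
  obtain d :: int where d: "d \<noteq> 0" "\<forall>x\<in>\<Union>e\<in>S. set (coeffs (P e)). of_int d * x \<in> \<int>"
    by (elim exE conjE)
  \<comment> \<open>The floor is exact, since \<open>d\<close> times each coefficient is an
    integer.\<close>
  define C where "C e = map_poly (\<lambda>x. \<lfloor>of_int d * x\<rfloor>) (P e)" for e
  have C: "map_poly of_int (C e) = smult (of_int d) (P e)" if "e \<in> S" for e
  proof (rule poly_eqI)
    fix n
    have "of_int d * coeff (P e) n \<in> \<int>"
    proof (cases "coeff (P e) n = 0")
      case False
      hence "coeff (P e) n \<in> set (coeffs (P e))"
        using range_coeff[of "P e"] by blast
      thus ?thesis using d(2) that by blast
    qed simp
    thus "coeff (map_poly of_int (C e)) n = coeff (smult (of_int d) (P e)) n"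
      by (simp add: C_def coeff_map_poly)
  qed
  have "fps_of_int_fps (\<Sum>e\<in>S. fps_of_poly (C e) * (\<Prod>i\<in>{2..l}. frakf_fps i ^ e i)) =
      (\<Sum>e\<in>S. fps_of_poly (map_poly of_int (C e)) * M e)"
    by (simp add: M_def fps_of_int_fps_sum fps_of_int_fps_prod fps_of_int_fps_power
          fps_of_int_fps_simps fps_of_int_fps_of_poly fps_of_int_fps_frakf)
  also have "\<dots> = fps_const (of_int d) * (\<Sum>e\<in>S. fps_of_poly (P e) * M e)"
    unfolding sum_distrib_left by (rule sum.cong) (simp_all add: C fps_of_poly_smult mult.assoc)
  finally have "fps_of_int_fps (\<Sum>e\<in>S. fps_of_poly (C e) * (\<Prod>i\<in>{2..l}. frakf_fps i ^ e i)) =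
      (fps_of_int_fps 0 :: rat fps)"
    by (simp add: ratrel fps_of_int_fps_simps)
  hence "(\<Sum>e\<in>S. fps_of_poly (C e) * (\<Prod>i\<in>{2..l}. frakf_fps i ^ e i)) = 0"
    by (rule injD[OF inj_fps_of_int_fps])
  moreover have "\<exists>e\<in>S. C e \<noteq> 0"
  proof -
    obtain e where e: "e \<in> S" "P e \<noteq> 0" using Pnz by blast
    have "C e \<noteq> 0"
    proof
      assume "C e = 0"
      thus False using C[OF e(1)] e d(1) by simp
    qed
    thus ?thesis using e by blast
  qed
  ultimately show ?thesis
    unfolding frakf_relation_def using fin supp by blast
qed

text \<open>Beyond being an odd prime, \<open>p\<close> must keep root multiplicities below
  \<open>p - 1\<close>, the relation nontrivial, and distinct monomials in the
  \<open>central_fps i\<close> distinct modulo \<open>p\<close> below \<open>z ^ p\<close>, where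
  series and truncations agree.\<close>

definition good_reduction ::
    "nat \<Rightarrow> (nat \<Rightarrow> nat) set \<Rightarrow> ((nat \<Rightarrow> nat) \<Rightarrow> int poly) \<Rightarrow> nat \<Rightarrow> bool" where
  "good_reduction l S C p \<longleftrightarrow> prime p \<and> odd p \<and>
     (\<forall>e\<in>S. l * (\<Sum>i\<in>{2..l}. e i) < p - 1) \<and> (\<exists>e\<in>S. \<exists>n. \<not> int p dvd coeff (C e) n) \<and>
     (\<forall>e\<in>S. \<forall>e'\<in>S. e \<noteq> e' \<longrightarrow> (\<exists>n<p. \<not> int p dvd
        (fps_nth (\<Prod>i\<in>{2..l}. central_fps i ^ e i) n - fps_nth (\<Prod>i\<in>{2..l}. central_fps i ^ e' i) n)))"

lemma eventually_not_dvd: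
  assumes "m \<noteq> (0 :: int)"
  shows "eventually (\<lambda>p. \<not> int p dvd m) sequentially"
  using eventually_gt_at_top[of "nat \<bar>m\<bar>"]
proof eventually_elim
  case (elim p)
  show ?case
  proof
    assume "int p dvd m"
    hence "\<bar>int p\<bar> \<le> \<bar>m\<bar>" using assms by (rule dvd_imp_le_int[rotated])
    thus False using elim by simp
  qed
qed

text \<open>Apart from primality, each condition holds for all large \<open>p\<close>, since
  \<open>S\<close> is finite and a nonzero integer has no divisor exceeding its absolute value.
  There are arbitrarily large primes.\<close>

lemma good_reduction_exists:
  assumes rel: "frakf_relation l S C"
  shows "\<exists>p. good_reduction l S C p"
proof -
  have fin: "finite S" and supp: "\<And>e i. e \<in> S \<Longrightarrow> i \<notin> {2..l} \<Longrightarrow> e i = 0"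
    using rel by (auto simp: frakf_relation_def)
  obtain e0 n0 where e0: "e0 \<in> S" "coeff (C e0) n0 \<noteq> 0"
    using rel unfolding frakf_relation_def by (metis coeff_0 poly_eqI)
  have "eventually (\<lambda>p. \<forall>e\<in>S. l * (\<Sum>i\<in>{2..l}. e i) < p - 1) sequentially"
    unfolding eventually_ball_finite_distrib[OF fin]
  proof
    fix e :: "nat \<Rightarrow> nat"
    show "eventually (\<lambda>p. l * (\<Sum>i\<in>{2..l}. e i) < p - 1) sequentially"
      using eventually_gt_at_top[of "l * (\<Sum>i\<in>{2..l}. e i) + 1"] by eventually_elim auto
  qed
  moreover have "eventually (\<lambda>p. \<not> int p dvd coeff (C e0) n0) sequentially"
    using e0 by (intro eventually_not_dvd)
  moreover have "eventually (\<lambda>p. \<forall>e\<in>S. \<forall>e'\<in>S. e \<noteq> e' \<longrightarrow> (\<exists>n<p. \<not> int p dvd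
        (fps_nth (\<Prod>i\<in>{2..l}. central_fps i ^ e i) n - fps_nth (\<Prod>i\<in>{2..l}. central_fps i ^ e' i) n)))
      sequentially"
    unfolding eventually_ball_finite_distrib[OF fin]
  proof (intro ballI)
    fix e e' assume e: "e \<in> S" "e' \<in> S"
    show "eventually (\<lambda>p. e \<noteq> e' \<longrightarrow> (\<exists>n<p. \<not> int p dvd
        (fps_nth (\<Prod>i\<in>{2..l}. central_fps i ^ e i) n - fps_nth (\<Prod>i\<in>{2..l}. central_fps i ^ e' i) n)))
      sequentially"
    proof (cases "e = e'")
      case False
      hence "(\<Prod>i\<in>{2..l}. central_fps i ^ e i :: int fps) \<noteq> (\<Prod>i\<in>{2..l}. central_fps i ^ e' i)"
        using e supp by (intro central_products_neq) auto
      then obtain n where n: "fps_nth (\<Prod>i\<in>{2..l}. central_fps i ^ e i :: int fps) n -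
          fps_nth (\<Prod>i\<in>{2..l}. central_fps i ^ e' i) n \<noteq> 0"
        by (auto simp: fps_eq_iff)
      show ?thesis
        using eventually_not_dvd[OF n] eventually_gt_at_top[of n] by eventually_elim blast
    qed simp
  qed
  moreover note eventually_gt_at_top[of "2 :: nat"]
  ultimately have "eventually (\<lambda>p. prime p \<longrightarrow> good_reduction l S C p) sequentially"
  proof eventually_elim
    case (elim p)
    thus ?case using e0(1) prime_odd_nat[of p] unfolding good_reduction_def by blast
  qed
  then obtain N where "\<And>p. p \<ge> N \<Longrightarrow> prime p \<Longrightarrow> good_reduction l S C p"
    by (auto simp: eventually_sequentially)
  moreover obtain p where "prime p" "p > N" using bigger_prime by blast
  ultimately show ?thesis by (meson less_imp_le)
qed

text \<open>By \<open>central_poly_products_eq\<close> two products of truncations agree, but their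
  coefficients below \<open>z ^ p\<close> are reductions of integers that
  \<open>good_reduction\<close> keeps apart.\<close>

lemma no_good_reduction:
  assumes char: "CHAR('a::alg_closed_field) = p"
    and rel: "frakf_relation l S C" and good: "good_reduction l S C p"
  shows False
proof -
  have prime_char: "prime CHAR('a)" and "odd CHAR('a)"
    using good by (auto simp: good_reduction_def char)
  then obtain h where h: "CHAR('a) = 2 * h + 1" by (auto elim: oddE)
  define C' where "C' e = (map_poly of_int (C e) :: 'a poly)" for e
  have of_int_eq_0: "(of_int m = (0 :: 'a)) \<longleftrightarrow> int p dvd m" for m
    by (simp add: of_int_eq_0_iff_char_dvd char)
  have "(\<Sum>e\<in>S. fps_of_poly (C' e) * (\<Prod>i\<in>{2..l}. frakf_fps i ^ e i)) =
      fps_of_int_fps (\<Sum>e\<in>S. fps_of_poly (C e) * (\<Prod>i\<in>{2..l}. frakf_fps i ^ e i))"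
    by (simp add: C'_def fps_of_int_fps_sum fps_of_int_fps_prod fps_of_int_fps_power
          fps_of_int_fps_simps fps_of_int_fps_of_poly fps_of_int_fps_frakf)
  also have "\<dots> = 0"
    using rel by (simp add: frakf_relation_def fps_of_int_fps_simps)
  finally have "(\<Sum>e\<in>S. fps_of_poly (C' e) * (\<Prod>i\<in>{2..l}. frakf_fps i ^ e i)) = 0" .
  moreover have "\<exists>e\<in>S. C' e \<noteq> 0"
  proof -
    obtain e n where e: "e \<in> S" "\<not> int p dvd coeff (C e) n"
      using good by (auto simp: good_reduction_def)
    hence "coeff (C' e) n \<noteq> 0" by (simp add: C'_def coeff_map_poly of_int_eq_0)
    thus ?thesis using e by force
  qed
  moreover have "finite S" using rel by (simp add: frakf_relation_def)
  moreover have "\<And>e. e \<in> S \<Longrightarrow> l * (\<Sum>i\<in>{2..l}. e i) < CHAR('a) - 1"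
    using good by (auto simp: good_reduction_def char)
  ultimately obtain e e' where e: "e \<in> S" "e' \<in> S" "e \<noteq> e'"
      "(\<Prod>i\<in>{2..l}. central_poly i ^ e i) = (\<Prod>i\<in>{2..l}. central_poly i ^ e' i :: 'a poly)"
    using central_poly_products_eq[OF prime_char h] by blast
  obtain n where n: "n < p" "\<not> int p dvd (fps_nth (\<Prod>i\<in>{2..l}. central_fps i ^ e i) n -
      fps_nth (\<Prod>i\<in>{2..l}. central_fps i ^ e' i) n)"
    using good e(1-3) unfolding good_reduction_def by blast
  have "(of_int (fps_nth (\<Prod>i\<in>{2..l}. central_fps i ^ e i) n) :: 'a) =
      coeff (\<Prod>i\<in>{2..l}. central_poly i ^ e i) n" for e
  proof -
    have "(of_int (fps_nth (\<Prod>i\<in>{2..l}. central_fps i ^ e i) n) :: 'a) =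
        fps_nth (fps_of_int_fps (\<Prod>i\<in>{2..l}. central_fps i ^ e i)) n"
      by simp
    also have "\<dots> = fps_nth (\<Prod>i\<in>{2..l}. central_fps i ^ e i) n"
      unfolding fps_of_int_fps_prod fps_of_int_fps_power fps_of_int_fps_central ..
    also have "\<dots> = coeff (\<Prod>i\<in>{2..l}. central_poly i ^ e i) n"
      using n by (intro central_products_nth[OF prime_char h]) (simp add: char)
    finally show ?thesis .
  qed
  hence "of_int (fps_nth (\<Prod>i\<in>{2..l}. central_fps i ^ e i) n -
      fps_nth (\<Prod>i\<in>{2..l}. central_fps i ^ e' i) n) = (0 :: 'a)"
    unfolding of_int_diff by (simp add: e(4))
  thus False using n(2) unfolding of_int_eq_0 by contradiction
qed

text \<open>A type cannot depend on a prime variable. Since the theorem is a closed statement, the prime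
  can be fixed once and for all: it is a good prime for some relation, provided there is a relation.\<close>

definition reduction_prime :: nat where
  "reduction_prime = (SOME p. prime p \<and>
     ((\<exists>l S C. frakf_relation l S C) \<longrightarrow> (\<exists>l S C. frakf_relation l S C \<and> good_reduction l S C p)))"

lemma reduction_prime:
  "prime reduction_prime" (is ?A)
  "frakf_relation l S C \<Longrightarrow>
     \<exists>l S C. frakf_relation l S C \<and> good_reduction l S C reduction_prime" (is "_ \<Longrightarrow> ?B")
proof -
  let ?P = "\<lambda>p. prime p \<and>
     ((\<exists>l S C. frakf_relation l S C) \<longrightarrow> (\<exists>l S C. frakf_relation l S C \<and> good_reduction l S C p))"
  have "\<exists>p. ?P p"
  proof (cases "\<exists>l S C. frakf_relation l S C")
    case True
    then obtain l S C p where "frakf_relation l S C" "good_reduction l S C p"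
      using good_reduction_exists by blast
    thus ?thesis unfolding good_reduction_def by blast
  next
    case False
    thus ?thesis using two_is_prime_nat by blast
  qed
  hence "?P reduction_prime" unfolding reduction_prime_def by (rule someI_ex)
  thus ?A and "frakf_relation l S C \<Longrightarrow> ?B" by blast+
qed

text \<open>With exactly \<open>reduction_prime\<close> elements as index type,
  \<open>mod_ring\<close> is the prime field, whose algebraic closure is a field to which
  \<open>no_good_reduction\<close> applies.\<close>

typedef reduction_index = "{..<reduction_prime}"
  using prime_gt_0_nat[OF reduction_prime(1)] by blast

lemma CARD_reduction_index: "CARD(reduction_index) = reduction_prime"
  using type_definition.card[OF type_definition_reduction_index] by simp

instance reduction_index :: prime_card
  by standard (simp add: CARD_reduction_index reduction_prime)

theorem theorem2:
  fixes l :: nat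
  assumes "l \<ge> 2"
  shows "alg_indep_over_Qz frakf {2..l}"
proof (rule ccontr)
  assume "\<not> ?thesis"
  then obtain S C where "frakf_relation l S C" using frakf_relation_exists by blast
  \<comment> \<open>The fixed prime may belong to another relation, even with another
    \<open>l\<close>; any relation with good reduction gives the contradiction.\<close>
  then obtain l S C where "frakf_relation l S C" "good_reduction l S C reduction_prime"
    using reduction_prime(2) by blast
  moreover have "CHAR(reduction_index mod_ring alg_closure) = reduction_prime"
    by (simp add: CARD_reduction_index)
  ultimately show False by (rule no_good_reduction[rotated])
qed

end
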